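(* Let $n\ge 1$, $d\ge 1$, and let $T\in(\mathbb{R}^n)^{\otimes d}$ be a symmetric, nondegenerate tensor. For each integer $\lambda$ with $0\le\lambda\le n-1$, let $n_\lambda$ be the number of unit eigenvectors of $T$ of index $\lambda$. Then $$\sum_{\lambda=0}^{n-1}(-1)^\lambda n_\lambda=\begin{cases}0 & \text{if } n \text{ is even},\\ 2 & \text{if } n\text{ is odd}.\end{cases}$$
   Context: $\mathbb{R}^n$ carries the standard inner product and Euclidean norm, and $S^{n-1}$ is its unit sphere. A symmetric tensor $T=[T_{i_1\cdots i_d}]\in(\mathbb{R}^n)^{\otimes d}$ corresponds to the homogeneous polynomial $f(x)=\sum_{1\le i_1,\ldots,i_d\le n}T_{i_1\cdots i_d}x_{i_1}\cdots x_{i_d}$ of degree $d$. The unit eigenvectors of $T$ are the critical points of the restriction $f|_{S^{n-1}}\colon S^{n-1}\to\mathbb{R}$. An eigenvector is nondegenerate if it is a nondegenerate critical point of $f|_{S^{n-1}}$, i.e. the Hessian of $f|_{S^{n-1}}$ in local coordinates on $S^{n-1}$ is nonsingular there; its index is then its (Morse) index as a nondegenerate critical point, i.e. the number of negative eigenvalues of that Hessian counted with multiplicity. The tensor $T$ is nondegenerate if all its unit eigenvectors are nondegenerate. *)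

theory Defs
  imports
    "HOL-Analysis.Analysis"
    "HOL-Combinatorics.Permutations"
    "Jordan_Normal_Form.Char_Poly"
begin

no_notation Matrix.vec_index (infixl "$" 100)

section \<open>Smooth functions\<close>

fun C_k_on :: "nat \<Rightarrow> 'a::euclidean_space set \<Rightarrow> ('a \<Rightarrow> 'b::euclidean_space) \<Rightarrow> bool" where
  "C_k_on 0 W g \<longleftrightarrow> continuous_on W g"
| "C_k_on (Suc k) W g \<longleftrightarrow>
     (\<forall>x\<in>W. g differentiable (at x)) \<and>
     (\<forall>v. C_k_on k W (\<lambda>x. frechet_derivative g (at x) v))"

definition smooth_on :: "'a::euclidean_space set \<Rightarrow> ('a \<Rightarrow> 'b::euclidean_space) \<Rightarrow> bool" where
  "smooth_on W g \<longleftrightarrow> (\<forall>k. C_k_on k W g)"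


section \<open>Local coordinates on the unit sphere\<close>

text \<open>
  There is no type of dimension \<open>n - 1\<close> when \<open>n = 1\<close>, so the coordinate space is a subspace \<open>V\<close> of
  dimension \<open>n - 1\<close> with a basis \<open>e\<^sub>0, \<dots>, e\<^sub>n\<^sub>-\<^sub>2\<close>, the coordinates of \<open>\<Sum>i. t\<^sub>i e\<^sub>i\<close> being \<open>(t\<^sub>i)\<close>.
  As usual for maps on subsets of a Euclidean space, smoothness of \<open>\<phi>\<close> on \<open>W \<inter> V\<close> is stated by
  giving \<open>\<phi>\<close> on an open set \<open>W\<close>; the values of \<open>\<phi>\<close> outside \<open>V\<close> play no role.
\<close>

abbreviation coord_space :: "(nat \<Rightarrow> real^'n) \<Rightarrow> (real^'n) set" where
  "coord_space e \<equiv> span (e ` {..<CARD('n) - 1})"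

definition sphere_coordinates_at ::
    "real^'n \<Rightarrow> (real^'n) set \<Rightarrow> (nat \<Rightarrow> real^'n) \<Rightarrow> (real^'n \<Rightarrow> real^'n) \<Rightarrow> real^'n \<Rightarrow> bool" where
  "sphere_coordinates_at p W e \<phi> u \<longleftrightarrow>
     inj_on e {..<CARD('n) - 1} \<and> independent (e ` {..<CARD('n) - 1}) \<and>
     open W \<and> smooth_on W \<phi> \<and>
     openin (top_of_set (sphere 0 1)) (\<phi> ` (W \<inter> coord_space e)) \<and>
     (\<exists>\<psi>. homeomorphism (W \<inter> coord_space e) (\<phi> ` (W \<inter> coord_space e)) \<phi> \<psi>) \<and>
     (\<forall>x \<in> W \<inter> coord_space e. \<forall>v \<in> coord_space e.
        frechet_derivative \<phi> (at x) v = 0 \<longrightarrow> v = 0) \<and>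
     u \<in> W \<inter> coord_space e \<and> \<phi> u = p"

definition coord_deriv ::
    "(nat \<Rightarrow> real^'n) \<Rightarrow> nat \<Rightarrow> (real^'n \<Rightarrow> real) \<Rightarrow> real^'n \<Rightarrow> real" where
  "coord_deriv e i g x = deriv (\<lambda>t. g (x + t *\<^sub>R e i)) 0"

definition coord_Hessian ::
    "(nat \<Rightarrow> real^'n) \<Rightarrow> (real^'n \<Rightarrow> real) \<Rightarrow> real^'n \<Rightarrow> real mat" where
  "coord_Hessian e g x =
     Matrix.mat (CARD('n) - 1) (CARD('n) - 1) (\<lambda>(i, j). coord_deriv e i (coord_deriv e j g) x)"


section \<open>Critical points of the restriction of a function to the unit sphere\<close>

text \<open>
  Criticality does not depend on the choice of local coordinates and, at a critical point, neither do
  nonsingularity of the Hessian and its number of negative eigenvalues.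
\<close>

definition sphere_critical_point :: "(real^'n \<Rightarrow> real) \<Rightarrow> real^'n \<Rightarrow> bool" where
  "sphere_critical_point f p \<longleftrightarrow>
     (\<exists>W e \<phi> u. sphere_coordinates_at p W e \<phi> u \<and>
        (\<forall>i < CARD('n) - 1. coord_deriv e i (f \<circ> \<phi>) u = 0))"

definition sphere_nondegenerate_critical_point :: "(real^'n \<Rightarrow> real) \<Rightarrow> real^'n \<Rightarrow> bool" where
  "sphere_nondegenerate_critical_point f p \<longleftrightarrow>
     sphere_critical_point f p \<and>
     (\<exists>W e \<phi> u. sphere_coordinates_at p W e \<phi> u \<and>
        Determinant.det (coord_Hessian e (f \<circ> \<phi>) u) \<noteq> 0)"

definition num_negative_eigenvalues :: "real mat \<Rightarrow> nat" where
  "num_negative_eigenvalues H = (\<Sum>a | eigenvalue H a \<and> a < 0. order a (char_poly H))"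

definition sphere_morse_index :: "(real^'n \<Rightarrow> real) \<Rightarrow> real^'n \<Rightarrow> nat" where
  "sphere_morse_index f p =
     (SOME k. \<exists>W e \<phi> u. sphere_coordinates_at p W e \<phi> u \<and>
        k = num_negative_eigenvalues (coord_Hessian e (f \<circ> \<phi>) u))"


section \<open>Tensors and their eigenvectors\<close>

text \<open>
  A tensor of order \<open>d\<close> is given by its entries, indexed by the lists of length \<open>d\<close>; values at lists
  of any other length are ignored.
\<close>

definition symmetric_tensor :: "nat \<Rightarrow> ('n list \<Rightarrow> real) \<Rightarrow> bool" where
  "symmetric_tensor d T \<longleftrightarrow>
     (\<forall>is \<sigma>. length is = d \<and> \<sigma> permutes {..<d} \<longrightarrow> T (permute_list \<sigma> is) = T is)"

definition tensor_poly :: "nat \<Rightarrow> ('n::finite list \<Rightarrow> real) \<Rightarrow> real^'n \<Rightarrow> real" where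
  "tensor_poly d T x = (\<Sum>is | length is = d. T is * (\<Prod>k<d. x $ (is ! k)))"

definition unit_eigenvectors :: "nat \<Rightarrow> ('n::finite list \<Rightarrow> real) \<Rightarrow> (real^'n) set" where
  "unit_eigenvectors d T = {x. norm x = 1 \<and> sphere_critical_point (tensor_poly d T) x}"

definition nondegenerate_tensor :: "nat \<Rightarrow> ('n::finite list \<Rightarrow> real) \<Rightarrow> bool" where
  "nondegenerate_tensor d T \<longleftrightarrow>
     (\<forall>x \<in> unit_eigenvectors d T. sphere_nondegenerate_critical_point (tensor_poly d T) x)"

definition num_eigenvectors_of_index :: "nat \<Rightarrow> ('n::finite list \<Rightarrow> real) \<Rightarrow> nat \<Rightarrow> nat" where
  "num_eigenvectors_of_index d T l =
     card {x \<in> unit_eigenvectors d T. sphere_morse_index (tensor_poly d T) x = l}"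

end

(*
  Extend the gradient of f along the unit sphere to the field
    F(y) = y + (2 - |y|^2) (w(y) - y),   w(y) = |y|^2 grad f(y) - <grad f(y), y> y,
  on the ball of radius sqrt 2.  As <F(y), y> = |y|^2 (|y|^2 - 1), the zeros of F are the origin, where
  DF = -id, and the critical points p of f on the sphere, where DF(p) maps the tangent space to itself
  by the Hessian of f on the sphere and is 2 on the normal line modulo the tangent space.  Hence
  (-1)^index(p) = sgn det DF(p).  Since F is the identity on the boundary of the ball it has degree 1,
  so the signs of det DF at the zeros add up to 1, that is (-1)^n + sum of (-1)^index(p) = 1.

  The degree is obtained without homology, by the argument of Milnor and Rogers: for polynomial phi the
  integral of phi(F_t) det DF_t over the ball, F_t = id + t (F - id), is a polynomial in t which is
  constant for small t.
*)
theory Submission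
  imports Defs
begin

section \<open>Analysis: the degree of a map of the ball as an integral\<close>

section \<open>A well-ordered copy of a finite index type\<close>

text \<open>A sum of signs over the sphere is a Poincare-Hopf count, but the sphere has no global
  coordinates in which to integrate. On a ball the count becomes a degree, and a degree is a ratio
  of two Euclidean integrals; this dictates the shape of F. The factor |y|^2 in w clears the
  denominator of the projection orthogonal to y, so that F is differentiable at the origin too. The
  weight 2 - |y|^2 equals 1 at radius 1, where it cancels y and leaves F = w, and 2 at the origin,
  where it reverses y; its zero fixes the radius sqrt 2.

  Polynomial test functions are what makes the integral polynomial in t; uniform approximation then
  carries the identity over to a bump function, which localizes it at the zeros.

  The Morse index is defined by choosing some chart. Since the sign of the Hessian determinant is
  that of det DF(p), in which no chart occurs, all charts give the index the same parity, and the
  alternating sum depends on the index only through its parity and the bound n - 1.\<close>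

text \<open>
  The change-of-variables theorem of the library is only available for index types of class
  \<^class>\<open>wellorder\<close>; results about arbitrary finite index types are transferred from this copy.
\<close>

typedef ('n::finite) ix = "UNIV :: 'n set" by simp

instance ix :: (finite) finite
proof
  have "(UNIV :: 'a ix set) = range Abs_ix"
    by (metis UNIV_eq_I Rep_ix_inverse rangeI)
  then show "finite (UNIV :: 'a ix set)"
    by (metis finite_imageI finite)
qed

definition enumerate_index :: "'n::finite \<Rightarrow> nat" where
  "enumerate_index = (SOME f. inj f)"

lemma inj_enumerate_index: "inj (enumerate_index :: 'n::finite \<Rightarrow> nat)"
  unfolding enumerate_index_def
  using finite_imp_inj_to_nat_seg[OF finite[of "UNIV :: 'n set"]] by (metis someI)

instantiation ix :: (finite) wellorder
begin

definition "less_eq_ix (a::'a ix) (b::'a ix) \<longleftrightarrow> enumerate_index (Rep_ix a) \<le> enumerate_index (Rep_ix b)"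
definition "less_ix (a::'a ix) (b::'a ix) \<longleftrightarrow> enumerate_index (Rep_ix a) < enumerate_index (Rep_ix b)"

instance
proof
  fix P :: "'a ix \<Rightarrow> bool" and a
  assume *: "\<And>x. (\<And>y. y < x \<Longrightarrow> P y) \<Longrightarrow> P x"
  show "P a"
    by (induction "enumerate_index (Rep_ix a)" arbitrary: a rule: less_induct)
      (metis * less_ix_def)
qed (auto simp: less_eq_ix_def less_ix_def Rep_ix_inject dest: injD[OF inj_enumerate_index] intro: antisym)

end

section \<open>Functions depending polynomially on a parameter\<close>

text \<open>The degree bound is uniform in \<open>y\<close> and the coefficients are continuous on
  \<open>S\<close>, so that integration over a compact \<open>S\<close> can be done coefficient by
  coefficient and yields a polynomial in \<open>t\<close>.\<close>

definition poly_family :: "'a::topological_space set \<Rightarrow> (real \<Rightarrow> 'a \<Rightarrow> real) \<Rightarrow> bool" where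
  "poly_family S P \<longleftrightarrow> (\<exists>c N. (\<forall>y. degree (c y) \<le> N) \<and> (\<forall>k. continuous_on S (\<lambda>y. coeff (c y) k)) \<and>
     (\<forall>t. \<forall>y\<in>S. P t y = poly (c y) t))"

lemma poly_family_coeff:
  assumes "continuous_on S c" shows "poly_family S (\<lambda>t. c)"
  unfolding poly_family_def
proof (intro exI conjI allI ballI)
  fix y k t
  show "degree [:c y:] \<le> 0" by simp
  show "continuous_on S (\<lambda>y. coeff [:c y:] k)"
    using assms by (cases k) auto
  show "c y = poly [:c y:] t" by simp
qed

lemma poly_family_var: "poly_family S (\<lambda>t y. t)"
  unfolding poly_family_def by (rule exI[of _ "\<lambda>_. [:0, 1:]"], rule exI[of _ 1]) auto

lemma poly_family_add:
  assumes "poly_family S P" "poly_family S Q"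
  shows "poly_family S (\<lambda>t y. P t y + Q t y)"
proof -
  from assms obtain c d M N where
    c: "\<And>y. degree (c y) \<le> M" "\<And>k. continuous_on S (\<lambda>y. coeff (c y) k)" "\<And>t y. y \<in> S \<Longrightarrow> P t y = poly (c y) t"
    and d: "\<And>y. degree (d y) \<le> N" "\<And>k. continuous_on S (\<lambda>y. coeff (d y) k)" "\<And>t y. y \<in> S \<Longrightarrow> Q t y = poly (d y) t"
    unfolding poly_family_def by blast
  show ?thesis
    unfolding poly_family_def
  proof (intro exI conjI allI ballI)
    fix y k t
    show "degree (c y + d y) \<le> max M N"
      using c(1)[of y] d(1)[of y] by (intro degree_add_le) auto
    show "continuous_on S (\<lambda>y. coeff (c y + d y) k)"
      using c(2) d(2) by (auto intro: continuous_intros)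
  qed (simp add: c d)
qed

lemma poly_family_mult:
  assumes "poly_family S P" "poly_family S Q"
  shows "poly_family S (\<lambda>t y. P t y * Q t y)"
proof -
  from assms obtain c d M N where
    c: "\<And>y. degree (c y) \<le> M" "\<And>k. continuous_on S (\<lambda>y. coeff (c y) k)" "\<And>t y. y \<in> S \<Longrightarrow> P t y = poly (c y) t"
    and d: "\<And>y. degree (d y) \<le> N" "\<And>k. continuous_on S (\<lambda>y. coeff (d y) k)" "\<And>t y. y \<in> S \<Longrightarrow> Q t y = poly (d y) t"
    unfolding poly_family_def by blast
  show ?thesis
    unfolding poly_family_def
  proof (intro exI conjI allI ballI)
    fix y k t
    show "degree (c y * d y) \<le> M + N"
      using c(1)[of y] d(1)[of y] degree_mult_le[of "c y" "d y"] by linarith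
    show "continuous_on S (\<lambda>y. coeff (c y * d y) k)"
      unfolding coeff_mult by (intro continuous_on_sum continuous_on_mult c(2) d(2))
  qed (simp add: c d)
qed

lemma poly_family_sum:
  assumes "finite I" "\<And>i. i \<in> I \<Longrightarrow> poly_family S (P i)"
  shows "poly_family S (\<lambda>t y. \<Sum>i\<in>I. P i t y)"
  using assms by (induction I rule: finite_induct) (auto intro: poly_family_coeff poly_family_add)

lemma poly_family_prod:
  assumes "finite I" "\<And>i. i \<in> I \<Longrightarrow> poly_family S (P i)"
  shows "poly_family S (\<lambda>t y. \<Prod>i\<in>I. P i t y)"
  using assms by (induction I rule: finite_induct) (auto intro: poly_family_coeff poly_family_mult)

text \<open>Along \<open>y + t *\<^sub>R g y\<close> a linear function is affine in
  \<open>t\<close>, and polynomial functions arise from linear ones and constants by sums and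
  products.\<close>

lemma poly_family_real_polynomial_function:
  assumes "real_polynomial_function q" and g: "continuous_on S g"
  shows "poly_family S (\<lambda>t y. q (y + t *\<^sub>R g y))"
  using assms(1)
proof induction
  case (linear f)
  then have "f (y + t *\<^sub>R g y) = f y + t * f (g y)" for y t
    by (simp add: bounded_linear.linear linear_add linear_scale)
  moreover have "continuous_on S f" "continuous_on S (\<lambda>y. f (g y))"
    using linear g by (auto intro: linear_continuous_on bounded_linear.continuous_on)
  ultimately show ?case
    by (auto intro!: poly_family_add poly_family_mult poly_family_var poly_family_coeff)
qed (auto intro: poly_family_coeff poly_family_add poly_family_mult)

lemma absolutely_integrable_continuous_compact:
  fixes f :: "'a::euclidean_space \<Rightarrow> 'b::euclidean_space"
  assumes "compact S" "continuous_on S f"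
  shows "f absolutely_integrable_on S"
  using borel_integrable_compact[OF assms]
  unfolding set_integrable_def
  by (metis borel_measurable_integrable integrable_completion)

lemma poly_family_integral:
  fixes S :: "'a::euclidean_space set"
  assumes "poly_family S P" "compact S"
  shows "\<exists>q. \<forall>t. integral S (P t) = poly q t"
proof -
  from assms obtain c M where
    c: "\<And>y. degree (c y) \<le> M" "\<And>k. continuous_on S (\<lambda>y. coeff (c y) k)" "\<And>t y. y \<in> S \<Longrightarrow> P t y = poly (c y) t"
    unfolding poly_family_def by blast
  have int: "(\<lambda>y. coeff (c y) k) integrable_on S" for k
    using absolutely_integrable_continuous_compact[OF assms(2) c(2)]
    by (rule absolutely_integrable_on_def[THEN iffD1, THEN conjunct1])
  have "integral S (P t) = poly (\<Sum>k\<le>M. monom (integral S (\<lambda>y. coeff (c y) k)) k) t" for t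
  proof -
    have "integral S (P t) = integral S (\<lambda>y. \<Sum>k\<le>M. coeff (c y) k * t ^ k)"
    proof (intro integral_cong)
      fix y assume "y \<in> S"
      then have "P t y = poly (\<Sum>k\<le>M. monom (coeff (c y) k) k) t"
        using c(1) by (simp add: c(3) poly_as_sum_of_monoms')
      then show "P t y = (\<Sum>k\<le>M. coeff (c y) k * t ^ k)"
        by (simp add: poly_sum poly_monom)
    qed
    also have "\<dots> = (\<Sum>k\<le>M. integral S (\<lambda>y. coeff (c y) k * t ^ k))"
      using int by (intro integral_sum integrable_on_mult_left) auto
    finally show ?thesis
      using int by (simp add: poly_sum poly_monom)
  qed
  then show ?thesis by blast
qed

section \<open>Small perturbations of the identity of a ball\<close>

abbreviation ldet :: "(real^'n \<Rightarrow> real^'n) \<Rightarrow> real" where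
  "ldet f \<equiv> Determinants.det (matrix f)"

text \<open>The Leibniz formula reduces continuity of the Jacobian determinant, and its polynomial
  dependence on a parameter, to the same properties of the entries.\<close>

lemma ldet_expand:
  "ldet f = (\<Sum>p | p permutes UNIV. of_int (sign p) * (\<Prod>i\<in>UNIV. f (axis (p i) 1) $ i))"
  by (simp add: Determinants.det_def matrix_def)

lemma continuous_on_ldet:
  assumes "\<And>v. continuous_on S (\<lambda>x. f x v)"
  shows "continuous_on S (\<lambda>x. ldet (f x))"
  unfolding ldet_expand
  by (intro continuous_on_sum continuous_on_mult continuous_on_prod continuous_on_const
      continuous_on_component assms)

lemma integral_change_of_variables_scalar:
  fixes f :: "real^'m::{finite,wellorder} \<Rightarrow> real" and g :: "real^'m::_ \<Rightarrow> real^'m::_"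
  assumes "S \<in> sets lebesgue"
    and "\<And>x. x \<in> S \<Longrightarrow> (g has_derivative g' x) (at x within S)"
    and "inj_on g S"
    and f: "f absolutely_integrable_on g ` S"
  shows "integral S (\<lambda>x. \<bar>ldet (g' x)\<bar> * f (g x)) = integral (g ` S) f"
proof -
  \<comment> \<open>The real integrand is wrapped into \<open>real^1\<close>, because the change of
    variables used here concerns vector-valued functions.\<close>
  have "(\<lambda>x. \<bar>ldet (g' x)\<bar> *\<^sub>R Finite_Cartesian_Product.vec (f (g x)) :: real^1) absolutely_integrable_on S \<and>
      integral S (\<lambda>x. \<bar>ldet (g' x)\<bar> *\<^sub>R Finite_Cartesian_Product.vec (f (g x))) = (Finite_Cartesian_Product.vec (integral (g ` S) f) :: real^1)
    \<longleftrightarrow> (\<lambda>x. Finite_Cartesian_Product.vec (f x) :: real^1) absolutely_integrable_on (g ` S) \<and>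
      integral (g ` S) (\<lambda>x. Finite_Cartesian_Product.vec (f x)) = (Finite_Cartesian_Product.vec (integral (g ` S) f) :: real^1)"
    by (rule has_absolute_integral_change_of_variables[OF assms(1-3)])
  with f show ?thesis
    by (simp add: absolutely_integrable_on_1_iff integral_on_1_eq)
qed

text \<open>The operator norm is dominated by the sum of the norms of the images of the basis
  vectors, which is continuous as soon as every \<open>g' x v\<close> is.\<close>

lemma onorm_bound_compact:
  fixes g' :: "'a::topological_space \<Rightarrow> 'b::euclidean_space \<Rightarrow> 'c::real_normed_vector"
  assumes "compact S" and "\<And>x. x \<in> S \<Longrightarrow> bounded_linear (g' x)"
    and "\<And>v. continuous_on S (\<lambda>x. g' x v)"
  obtains L where "L > 0" "\<And>x. x \<in> S \<Longrightarrow> onorm (g' x) \<le> L"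
proof -
  have "continuous_on S (\<lambda>x. \<Sum>b\<in>Basis. norm (g' x b))"
    using assms(3) by (intro continuous_intros)
  then have "bounded ((\<lambda>x. \<Sum>b\<in>Basis. norm (g' x b)) ` S)"
    by (rule compact_imp_bounded[OF compact_continuous_image[OF _ assms(1)]])
  then obtain L where L: "L > 0" "\<And>x. x \<in> S \<Longrightarrow> norm (\<Sum>b\<in>Basis. norm (g' x b)) \<le> L"
    unfolding bounded_pos by auto
  show thesis
  proof
    show "onorm (g' x) \<le> L" if "x \<in> S" for x
      using onorm_componentwise[OF assms(2)[OF that]] L(2)[OF that] unfolding real_norm_def by linarith
  qed fact
qed

text \<open>For one point inside the ball and one outside, the segment between them meets the
  boundary sphere, where \<open>g\<close> is 0; comparing with that point keeps the same Lipschitz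
  constant.\<close>

lemma lipschitz_extend_zero:
  fixes g :: "'a::euclidean_space \<Rightarrow> 'b::real_normed_vector"
  assumes "0 < r" and lip: "\<And>x y. x \<in> cball 0 r \<Longrightarrow> y \<in> cball 0 r \<Longrightarrow> norm (g x - g y) \<le> L * norm (x - y)"
    and "0 \<le> L" and zero: "\<And>x. norm x = r \<Longrightarrow> g x = 0"
  defines "h \<equiv> \<lambda>x. if x \<in> cball 0 r then g x else 0"
  shows "norm (h x - h y) \<le> L * norm (x - y)"
proof -
  have *: "norm (g x) \<le> L * norm (x - y)" if x: "x \<in> cball 0 r" and y: "y \<notin> cball 0 r" for x y
  proof -
    have "closed_segment x y \<inter> frontier (cball 0 r) \<noteq> {}"
      using x y by (intro connected_Int_frontier) auto
    then obtain z where z: "z \<in> closed_segment x y" "norm z = r"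
      by (metis disjoint_iff frontier_cball mem_sphere_0)
    have "norm (g x - g z) \<le> L * norm (x - z)"
      using x z by (intro lip) auto
    also have "\<dots> \<le> L * norm (x - y)"
      using dist_in_closed_segment[OF z(1)] \<open>0 \<le> L\<close>
      by (intro mult_left_mono) (auto simp: dist_norm norm_minus_commute)
    finally show ?thesis using zero[OF z(2)] by simp
  qed
  show ?thesis
    using *[of x y] *[of y x] lip[of x y] \<open>0 \<le> L\<close>
    by (auto simp: h_def norm_minus_commute)
qed

text \<open>Extend \<open>g\<close> by 0 to the whole space. There
  \<open>z - t *\<^sub>R h x\<close> is a contraction in \<open>x\<close>, and its fixed point is
  the preimage of \<open>z\<close>, so the perturbed identity is bijective. It fixes every point
  outside the ball, hence by injectivity no point of the ball can be moved out of it.\<close>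

lemma bij_betw_perturbed_identity:
  fixes g :: "'a::euclidean_space \<Rightarrow> 'a"
  assumes "0 < r" and lip: "\<And>x y. x \<in> cball 0 r \<Longrightarrow> y \<in> cball 0 r \<Longrightarrow> norm (g x - g y) \<le> L * norm (x - y)"
    and "0 \<le> L" and zero: "\<And>x. norm x = r \<Longrightarrow> g x = 0"
    and t: "0 \<le> t" "t * L < 1"
  shows "bij_betw (\<lambda>y. y + t *\<^sub>R g y) (cball 0 r) (cball 0 r)"
proof -
  define h where "h x = (if x \<in> cball 0 r then g x else 0)" for x
  have "norm (h x - h y) \<le> L * norm (x - y)" for x y
    unfolding h_def using lipschitz_extend_zero[of r g L] assms by blast
  then have th: "norm (t *\<^sub>R h x - t *\<^sub>R h y) \<le> t * L * norm (x - y)" for x y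
    using t(1) by (simp flip: scaleR_diff_right add: mult_left_mono mult.assoc)
  have inj: "x = y" if "x + t *\<^sub>R h x = y + t *\<^sub>R h y" for x y
  proof (rule ccontr)
    assume "x \<noteq> y"
    have "x - y = t *\<^sub>R h y - t *\<^sub>R h x"
      using that by (simp add: algebra_simps)
    then have "norm (x - y) \<le> t * L * norm (x - y)"
      using th[of y x] by (simp add: norm_minus_commute)
    moreover have "t * L * norm (x - y) < 1 * norm (x - y)"
      using t \<open>x \<noteq> y\<close> by (intro mult_strict_right_mono) auto
    ultimately show False by simp
  qed
  have "\<exists>!x. z - t *\<^sub>R h x = x" for z
    using th t \<open>0 \<le> L\<close>
    by (intro banach_fix_type[where c = "t * L"]) (auto simp: dist_norm norm_minus_commute)
  then have surj: "\<exists>x. x + t *\<^sub>R h x = z" for z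
    by (metis diff_add_cancel)
  have stay: "x + t *\<^sub>R h x \<in> cball 0 r \<longleftrightarrow> x \<in> cball 0 r" for x
  proof -
    have "h z = 0" if "z \<notin> cball 0 r" for z
      using that by (simp add: h_def)
    then show ?thesis
      using inj[of x "x + t *\<^sub>R h x"] by (metis add.right_neutral scaleR_zero_right)
  qed
  have "bij_betw (\<lambda>x. x + t *\<^sub>R h x) (cball 0 r) (cball 0 r)"
    unfolding bij_betw_def
  proof
    show "inj_on (\<lambda>x. x + t *\<^sub>R h x) (cball 0 r)"
      using inj by (auto intro: inj_onI)
    show "(\<lambda>x. x + t *\<^sub>R h x) ` cball 0 r = cball 0 r"
    proof (intro equalityI subsetI)
      fix z :: 'a assume z: "z \<in> cball 0 r"
      obtain x where x: "x + t *\<^sub>R h x = z" using surj by blast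
      then have "x \<in> cball 0 r" using stay z by blast
      with x show "z \<in> (\<lambda>x. x + t *\<^sub>R h x) ` cball 0 r" by blast
    qed (use stay in blast)
  qed
  moreover have "bij_betw (\<lambda>y. y + t *\<^sub>R g y) (cball 0 r) (cball 0 r) \<longleftrightarrow>
      bij_betw (\<lambda>x. x + t *\<^sub>R h x) (cball 0 r) (cball 0 r)"
    by (rule bij_betw_cong) (simp add: h_def)
  ultimately show ?thesis by blast
qed

text \<open>The determinant is 1 at parameter 0, so it could become nonpositive only by vanishing at
  some \<open>s\<close> between 0 and \<open>t\<close>. That would give a nonzero \<open>h\<close>
  with \<open>h = - s *\<^sub>R f h\<close>, which \<open>t * L < 1\<close> forbids.\<close>

lemma ldet_perturbed_identity_pos:
  fixes f :: "real^'n \<Rightarrow> real^'n"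
  assumes f: "bounded_linear f" and "onorm f \<le> L" and t: "0 \<le> t" "t * L < 1"
  shows "ldet (\<lambda>h. h + t *\<^sub>R f h) > 0"
proof (rule ccontr)
  let ?d = "\<lambda>s. ldet (\<lambda>h. h + s *\<^sub>R f h)"
  assume "\<not> ?d t > 0"
  moreover have "?d 0 = 1" by (simp add: matrix_id_mat_1[unfolded id_def])
  moreover have "continuous_on {0..t} ?d"
    by (intro continuous_on_ldet continuous_intros)
  ultimately obtain s where s: "0 \<le> s" "s \<le> t" "?d s = 0"
    using IVT2'[of ?d t 0 0] t by auto
  interpret bounded_linear f by fact
  have lin: "linear (\<lambda>h. h + s *\<^sub>R f h)"
    by (rule linearI) (auto simp: add scale algebra_simps)
  have "h = 0" if "h + s *\<^sub>R f h = 0" for h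
  proof (rule ccontr)
    assume "h \<noteq> 0"
    have "h = - (s *\<^sub>R f h)" using that by (simp add: eq_neg_iff_add_eq_0)
    then have "norm h = s * norm (f h)"
      using s(1) by (metis abs_of_nonneg norm_minus_cancel norm_scaleR)
    also have "\<dots> \<le> t * (L * norm h)"
      using s t onorm[OF f, of h] \<open>onorm f \<le> L\<close>
      by (intro mult_mono order_trans[OF onorm[OF f, of h]] mult_right_mono) auto
    also have "\<dots> < norm h"
      using t \<open>h \<noteq> 0\<close> by (simp flip: mult.assoc)
    finally show False by simp
  qed
  then have "inj (\<lambda>h. h + s *\<^sub>R f h)"
    using linear_inj_iff_eq_0[OF lin] by blast
  then show False
    using s(3) det_nz_iff_inj[OF lin] by simp
qed

section \<open>The degree of a map that is the identity on a sphere\<close>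

lemma eq_0_if_abs_le_mult:
  fixes a K :: real
  assumes "\<And>e. 0 < e \<Longrightarrow> \<bar>a\<bar> \<le> e * K" and "0 < K"
  shows "a = 0"
proof (rule ccontr)
  assume "a \<noteq> 0"
  then have "\<bar>a\<bar> \<le> (\<bar>a\<bar> / (2 * K)) * K"
    using \<open>0 < K\<close> by (intro assms(1)) simp
  with \<open>a \<noteq> 0\<close> \<open>0 < K\<close> show False by simp
qed

context
  fixes F :: "real^'n::{finite,wellorder} \<Rightarrow> real^'n::_" and F' and r :: real
  assumes r: "0 < r"
    and derF: "\<And>x. (F has_derivative F' x) (at x)"
    and contF': "\<And>v. continuous_on UNIV (\<lambda>x. F' x v)"
    and bdry: "\<And>x. norm x = r \<Longrightarrow> F x = x"
begin

lemma continuous_on_F [continuous_intros]: "continuous_on S F"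
  using derF by (intro has_derivative_continuous_on) (auto intro: has_derivative_at_withinI)

lemma continuous_on_ldet_F' [continuous_intros]: "continuous_on S (\<lambda>x. ldet (F' x))"
  by (intro continuous_on_ldet continuous_on_subset[OF contF']) simp

text \<open>Below 1 / \<open>L\<close>, with \<open>L\<close> a Lipschitz constant of
  \<open>F y - y\<close>, the homotopy maps the ball bijectively to itself and has positive
  Jacobian, so the change of variables holds without the absolute value.\<close>

lemma integral_homotopy_small:
  assumes \<phi>: "continuous_on UNIV \<phi>"
  obtains \<delta> where "0 < \<delta>" and "\<And>t. 0 \<le> t \<Longrightarrow> t < \<delta> \<Longrightarrow>
    integral (cball 0 r) (\<lambda>y. \<phi> (y + t *\<^sub>R (F y - y)) * ldet (\<lambda>h. h + t *\<^sub>R (F' y h - h))) =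
    integral (cball 0 r) \<phi>"
proof -
  let ?B = "cball 0 r :: (real^'n::_) set"
  define g where "g y = F y - y" for y
  define g' where "g' y h = F' y h - h" for y h
  have derg: "(g has_derivative g' x) (at x within S)" for x S
    unfolding g_def g'_def by (intro derivative_intros has_derivative_at_withinI[OF derF])
  have contg': "continuous_on S (\<lambda>x. g' x v)" for v S
    unfolding g'_def by (intro continuous_intros continuous_on_subset[OF contF']) simp
  obtain L where L: "L > 0" "\<And>x. x \<in> ?B \<Longrightarrow> onorm (g' x) \<le> L"
    using onorm_bound_compact[OF compact_cball has_derivative_bounded_linear[OF derg] contg'] by metis
  have lip: "norm (g x - g y) \<le> L * norm (x - y)" if "x \<in> ?B" "y \<in> ?B" for x y
    by (rule differentiable_bound[OF convex_cball[of 0 r] derg L(2)]) (use that in auto)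
  show thesis
  proof
    show "0 < 1 / L" using L by simp
    fix t :: real assume t: "0 \<le> t" "t < 1 / L"
    then have tL: "t * L < 1" using L by (simp add: field_simps)
    let ?G = "\<lambda>y. y + t *\<^sub>R g y" and ?G' = "\<lambda>y h. h + t *\<^sub>R g' y h"
    have bij: "bij_betw ?G ?B ?B"
      by (rule bij_betw_perturbed_identity[of r g L]) (use r lip L tL t bdry in \<open>auto simp: g_def\<close>)
    have "integral ?B (\<lambda>y. \<phi> (?G y) * ldet (?G' y)) = integral ?B (\<lambda>y. \<bar>ldet (?G' y)\<bar> * \<phi> (?G y))"
      using ldet_perturbed_identity_pos[OF has_derivative_bounded_linear[OF derg] L(2) t(1) tL]
      by (intro integral_cong) (simp add: abs_of_pos)
    also have "\<dots> = integral (?G ` ?B) \<phi>"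
    proof (rule integral_change_of_variables_scalar)
      show "(?G has_derivative ?G' x) (at x within ?B)" for x
        by (intro derivative_intros derg)
      show "inj_on ?G ?B" using bij by (rule bij_betw_imp_inj_on)
      show "\<phi> absolutely_integrable_on ?G ` ?B"
        unfolding bij_betw_imp_surj_on[OF bij]
        by (intro absolutely_integrable_continuous_compact compact_cball continuous_on_subset[OF \<phi>]) simp
    qed (simp add: borel_closed)
    also have "?G ` ?B = ?B" by (rule bij_betw_imp_surj_on[OF bij])
    finally show "integral ?B (\<lambda>y. \<phi> (y + t *\<^sub>R (F y - y)) * ldet (\<lambda>h. h + t *\<^sub>R (F' y h - h))) =
        integral ?B \<phi>"
      by (simp add: g_def g'_def)
  qed
qed

text \<open>
  For polynomial \<open>q\<close> the integral along the homotopy \<open>y + t (F y - y)\<close> is a polynomial in \<open>t\<close>. It is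
  constant for small \<open>t\<close>, where the homotopy is a diffeomorphism of the ball, hence also at \<open>t = 1\<close>.
\<close>

lemma integral_pullback_polynomial:
  assumes q: "real_polynomial_function q"
  shows "integral (cball 0 r) (\<lambda>y. q (F y) * ldet (F' y)) = integral (cball 0 r) q"
proof -
  let ?B = "cball 0 r :: (real^'n::_) set"
  let ?P = "\<lambda>t y. q (y + t *\<^sub>R (F y - y)) * ldet (\<lambda>h. h + t *\<^sub>R (F' y h - h))"
  have contq: "continuous_on UNIV q"
    using q continuous_on_polymonial_function real_polynomial_function_eq by blast
  obtain \<delta> where \<delta>: "0 < \<delta>" "\<And>t. 0 \<le> t \<Longrightarrow> t < \<delta> \<Longrightarrow> integral ?B (?P t) = integral ?B q"
    using integral_homotopy_small[OF contq] by blast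
  have entry: "poly_family ?B (\<lambda>t y. (v + t *\<^sub>R (F' y v - v)) $ i)" for v i
    using continuous_on_subset[OF contF' subset_UNIV, of ?B v]
    by (auto intro!: poly_family_add poly_family_mult poly_family_var poly_family_coeff continuous_intros)
  have "poly_family ?B (\<lambda>t y. ldet (\<lambda>h. h + t *\<^sub>R (F' y h - h)))"
    unfolding ldet_expand
    by (intro poly_family_sum poly_family_mult poly_family_prod entry poly_family_coeff)
      (auto intro: finite_permutations)
  moreover have "poly_family ?B (\<lambda>t y. q (y + t *\<^sub>R (F y - y)))"
    by (intro poly_family_real_polynomial_function q continuous_intros)
  ultimately have "poly_family ?B ?P"
    by (rule poly_family_mult[rotated])
  then obtain p where p: "\<And>t. integral ?B (?P t) = poly p t"
    using poly_family_integral[OF _ compact_cball] by blast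
  have "p = [:integral ?B q:]"
  proof (rule ccontr)
    assume "p \<noteq> [:integral ?B q:]"
    then have "finite {t. poly (p - [:integral ?B q:]) t = 0}"
      by (intro poly_roots_finite) simp
    moreover have "{0<..<\<delta>} \<subseteq> {t. poly (p - [:integral ?B q:]) t = 0}"
      using \<delta>(2) by (auto simp flip: p)
    ultimately have "finite {0<..<\<delta>}" by (rule rev_finite_subset)
    with infinite_Ioo[OF \<delta>(1)] show False by blast
  qed
  then show ?thesis using p[of 1] by simp
qed

text \<open>The defect \<open>E\<close> is linear and vanishes on polynomials. A function bounded by
  \<open>e\<close> has defect at most \<open>e * (M + 1) * V\<close>: the summand \<open>M\<close>
  bounds the Jacobian in the pulled-back term, 1 belongs to the plain term, and \<open>V\<close> is
  the volume. Uniform approximation by polynomials therefore forces \<open>E\<close> to vanish on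
  every continuous function.\<close>

lemma integral_pullback:
  assumes \<phi>: "continuous_on UNIV \<phi>"
  shows "integral (cball 0 r) (\<lambda>y. \<phi> (F y) * ldet (F' y)) = integral (cball 0 r) \<phi>"
proof -
  let ?B = "cball 0 r :: (real^'n::_) set"
  have int: "f integrable_on ?B" if "continuous_on ?B f" for f :: "real^'n::_ \<Rightarrow> real"
    using absolutely_integrable_continuous_compact[OF compact_cball that]
    by (simp add: absolutely_integrable_on_def)
  have contF: "continuous_on ?B (\<lambda>y. f (F y))" if "continuous_on UNIV f" for f :: "real^'n::_ \<Rightarrow> real"
    by (rule continuous_on_compose2[OF that continuous_on_F]) simp
  have D: "continuous_on ?B (\<lambda>y. ldet (F' y))"
    by (rule continuous_on_ldet_F')
  have "bounded ((\<lambda>y. ldet (F' y)) ` ?B)"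
    by (rule compact_imp_bounded[OF compact_continuous_image[OF D compact_cball]])
  then obtain M where M: "M > 0" "\<And>y. y \<in> ?B \<Longrightarrow> norm (ldet (F' y)) \<le> M"
    unfolding bounded_pos by auto
  define V where "V = integral ?B (\<lambda>_. 1 :: real)"
  have "Henstock_Kurzweil_Integration.content ?B = V"
    unfolding V_def using lmeasure_integral[OF lmeasurable_cball, of "0 :: real^'n::_" r] by simp
  then have V: "V > 0"
    using content_cball_pos[OF r, of "0 :: real^'n::_"] by metis
  define E where "E f = integral ?B (\<lambda>y. f (F y) * ldet (F' y) - f y)" for f
  have E: "E f = integral ?B (\<lambda>y. f (F y) * ldet (F' y)) - integral ?B f"
    if "continuous_on UNIV f" for f
    unfolding E_def
    by (rule Henstock_Kurzweil_Integration.integral_diff[OF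
        int[OF continuous_on_mult[OF contF[OF that] D]] int[OF continuous_on_subset[OF that subset_UNIV]]])
  have intE: "(\<lambda>y. f (F y) * ldet (F' y) - f y) integrable_on ?B" if "continuous_on UNIV f" for f
    by (rule integrable_diff[OF
        int[OF continuous_on_mult[OF contF[OF that] D]] int[OF continuous_on_subset[OF that subset_UNIV]]])
  have "E \<phi> = 0"
  proof (rule eq_0_if_abs_le_mult)
    show "0 < (M + 1) * V" using M V by simp
    fix e :: real assume e: "0 < e"
    \<comment> \<open>The test function is evaluated at \<open>y\<close> and at \<open>F y\<close>,
      and \<open>F\<close> may leave the ball, so the approximation has to be uniform on the ball
      and on its image.\<close>
    have "compact (?B \<union> F ` ?B)"
      by (intro compact_Un compact_cball compact_continuous_image continuous_on_F)
    then obtain q where q: "real_polynomial_function q" "\<And>x. x \<in> ?B \<union> F ` ?B \<Longrightarrow> \<bar>\<phi> x - q x\<bar> < e"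
      using Stone_Weierstrass_real_polynomial_function[OF _ continuous_on_subset[OF \<phi> subset_UNIV] e] by blast
    have contq: "continuous_on UNIV q"
      using q(1) continuous_on_polymonial_function real_polynomial_function_eq by blast
    have cont: "continuous_on UNIV (\<lambda>y. \<phi> y - q y)"
      by (intro continuous_on_diff \<phi> contq)
    have "E q = 0"
      using integral_pullback_polynomial[OF q(1)] E[OF contq] by simp
    then have "E \<phi> = E \<phi> - E q" by simp
    also have "\<dots> = E (\<lambda>y. \<phi> y - q y)"
      unfolding E_def
      by (subst Henstock_Kurzweil_Integration.integral_diff[OF intE[OF \<phi>] intE[OF contq], symmetric])
        (simp add: algebra_simps)
    finally have "\<bar>E \<phi>\<bar> = norm (E (\<lambda>y. \<phi> y - q y))" by simp
    also have "\<dots> \<le> integral ?B (\<lambda>y. e * (M + 1))"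
      unfolding E_def
    proof (rule Henstock_Kurzweil_Integration.integral_norm_bound_integral)
      fix y assume y: "y \<in> ?B"
      have "\<bar>(\<phi> (F y) - q (F y)) * ldet (F' y)\<bar> \<le> e * M"
        unfolding abs_mult using q(2)[of "F y"] M(2)[OF y] y e
        by (intro mult_mono) (auto intro: less_imp_le)
      moreover have "\<bar>\<phi> y - q y\<bar> \<le> e"
        using q(2)[of y] y by (auto intro: less_imp_le)
      ultimately show "norm ((\<phi> (F y) - q (F y)) * ldet (F' y) - (\<phi> y - q y)) \<le> e * (M + 1)"
        unfolding real_norm_def by (simp add: algebra_simps abs_le_iff)
    qed (use intE[OF cont] integrable_on_const[OF lmeasurable_cball] in auto)
    also have "\<dots> = e * ((M + 1) * V)"
      unfolding V_def by (simp flip: integral_mult_right add: mult.assoc)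
    finally show "\<bar>E \<phi>\<bar> \<le> e * ((M + 1) * V)" .
  qed
  with E[OF \<phi>] show ?thesis by simp
qed

text \<open>An invertible derivative that varies continuously in operator norm makes
  \<open>F\<close> injective near \<open>z\<close>. A further shrinking keeps the Jacobian closer to
  its value at \<open>z\<close> than that value is to 0, which freezes its sign.\<close>

lemma local_injectivity:
  assumes "open S" "z \<in> S" and nz: "ldet (F' z) \<noteq> 0"
  obtains \<rho> where "0 < \<rho>" "ball z \<rho> \<subseteq> S" "inj_on F (ball z \<rho>)"
    "\<And>x. x \<in> ball z \<rho> \<Longrightarrow> sgn (ldet (F' x)) = sgn (ldet (F' z))"
proof -
  have lin: "linear (F' x)" for x
    using derF has_derivative_linear by blast
  then have "inj (F' z)" using nz det_nz_iff_inj by blast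
  then obtain G where G: "linear G" "G \<circ> F' z = id"
    using linear_injective_left_inverse[OF lin] by blast
  \<comment> \<open>Continuity of each \<open>F' x v\<close> is upgraded to operator norm by testing
    on the finitely many basis vectors.\<close>
  have onorm_small: "\<exists>d>0. \<forall>x. dist z x < d \<longrightarrow> onorm (\<lambda>v. F' x v - F' z v) < e" if "e > 0" for e
  proof -
    have "continuous_on UNIV (\<lambda>x. \<Sum>b\<in>Basis. norm (F' x b - F' z b))"
      by (intro continuous_intros contF')
    then have "\<exists>d>0. \<forall>x. dist x z < d \<longrightarrow>
        dist (\<Sum>b\<in>Basis. norm (F' x b - F' z b)) (\<Sum>b\<in>Basis. norm (F' z b - F' z b)) < e"
      using \<open>e > 0\<close> unfolding continuous_on_iff by blast
    then obtain d where d: "d > 0" "\<And>x. dist x z < d \<Longrightarrow> \<bar>\<Sum>b\<in>Basis. norm (F' x b - F' z b)\<bar> < e"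
      by (auto simp: dist_real_def)
    have "onorm (\<lambda>v. F' x v - F' z v) < e" if "dist z x < d" for x
    proof -
      have "bounded_linear (\<lambda>v. F' x v - F' z v)"
        by (intro bounded_linear_sub has_derivative_bounded_linear[OF derF])
      then have "onorm (\<lambda>v. F' x v - F' z v) \<le> (\<Sum>b\<in>Basis. norm (F' x b - F' z b))"
        by (rule onorm_componentwise)
      with d(2)[of x] that show ?thesis by (simp add: dist_commute)
    qed
    with d(1) show ?thesis by blast
  qed
  obtain \<rho>1 where \<rho>1: "0 < \<rho>1" "ball z \<rho>1 \<subseteq> S" "inj_on F (ball z \<rho>1)"
    using has_derivative_locally_injective[OF \<open>z \<in> S\<close> \<open>open S\<close> linear_conv_bounded_linear[THEN iffD1, OF G(1)], of F' F]
      G(2) derF onorm_small by metis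
  have "0 < \<bar>ldet (F' z)\<bar>" using nz by simp
  moreover have "continuous_on UNIV (\<lambda>x. ldet (F' x))"
    by (rule continuous_on_ldet_F')
  ultimately obtain \<rho>2 where \<rho>2: "0 < \<rho>2" "\<And>x. dist x z < \<rho>2 \<Longrightarrow> dist (ldet (F' x)) (ldet (F' z)) < \<bar>ldet (F' z)\<bar>"
    unfolding continuous_on_iff by blast
  show thesis
  proof
    show "0 < min \<rho>1 \<rho>2" "ball z (min \<rho>1 \<rho>2) \<subseteq> S"
      using \<rho>1 \<rho>2 by auto
    show "inj_on F (ball z (min \<rho>1 \<rho>2))"
      by (rule inj_on_subset[OF \<rho>1(3)]) auto
    fix x assume "x \<in> ball z (min \<rho>1 \<rho>2)"
    then have "dist (ldet (F' x)) (ldet (F' z)) < \<bar>ldet (F' z)\<bar>"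
      by (intro \<rho>2(2)) (simp add: dist_commute)
    then show "sgn (ldet (F' x)) = sgn (ldet (F' z))"
      by (auto simp: dist_real_def sgn_if split: if_splits)
  qed
qed


text \<open>
  Apply \<open>integral_pullback\<close> to a bump function \<open>\<phi>\<close> at \<open>0\<close> whose support is so small that its preimage
  under \<open>F\<close> splits into neighbourhoods of the zeros on which \<open>F\<close> is injective.
\<close>

lemma sum_sgn_ldet_wellorder:
  assumes nz: "\<And>z. z \<in> cball 0 r \<Longrightarrow> F z = 0 \<Longrightarrow> ldet (F' z) \<noteq> 0"
  shows "finite {z \<in> cball 0 r. F z = 0} \<and> (\<Sum>z | z \<in> cball 0 r \<and> F z = 0. sgn (ldet (F' z))) = 1"
proof -
  let ?B = "cball 0 r :: (real^'n::_) set"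
  define Z where "Z = {z \<in> ?B. F z = 0}"
  have Z_int: "z \<in> ball 0 r" if "z \<in> Z" for z
    using that bdry[of z] r by (auto simp: Z_def order.order_iff_strict)
  have "\<forall>z\<in>Z. \<exists>\<rho>. 0 < \<rho> \<and> ball z \<rho> \<subseteq> ball 0 r \<and> inj_on F (ball z \<rho>) \<and>
      (\<forall>x\<in>ball z \<rho>. sgn (ldet (F' x)) = sgn (ldet (F' z)))"
  proof
    fix z assume z: "z \<in> Z"
    then have "ldet (F' z) \<noteq> 0" using nz by (simp add: Z_def)
    then show "\<exists>\<rho>. 0 < \<rho> \<and> ball z \<rho> \<subseteq> ball 0 r \<and> inj_on F (ball z \<rho>) \<and>
        (\<forall>x\<in>ball z \<rho>. sgn (ldet (F' x)) = sgn (ldet (F' z)))"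
      by (rule local_injectivity[OF open_ball Z_int[OF z]]) blast
  qed
  from bchoice[OF this] obtain \<rho> where \<rho>: "\<And>z. z \<in> Z \<Longrightarrow> 0 < \<rho> z" "\<And>z. z \<in> Z \<Longrightarrow> ball z (\<rho> z) \<subseteq> ball 0 r"
    "\<And>z. z \<in> Z \<Longrightarrow> inj_on F (ball z (\<rho> z))"
    "\<And>z x. z \<in> Z \<Longrightarrow> x \<in> ball z (\<rho> z) \<Longrightarrow> sgn (ldet (F' x)) = sgn (ldet (F' z))"
    by blast
  have isolated: "x = z" if "z \<in> Z" "x \<in> Z" "x \<in> ball z (\<rho> z)" for x z
  proof -
    have "F x = F z" "z \<in> ball z (\<rho> z)"
      using that \<rho>(1) by (simp_all add: Z_def)
    with inj_onD[OF \<rho>(3)[OF that(1)]] that(3) show ?thesis by blast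
  qed
  \<comment> \<open>Each ball of the cover contains only one zero, its centre, so the centres of a
    finite subcover are all the zeros.\<close>
  have finZ: "finite Z"
  proof -
    have "Z = ?B \<inter> F -` {0}" by (auto simp: Z_def)
    then have "closed Z"
      using continuous_closed_preimage[OF continuous_on_F closed_cball, of "{0}" 0 r] by simp
    moreover have "bounded Z" by (rule bounded_subset[OF bounded_cball[of 0 r]]) (auto simp: Z_def)
    ultimately have cpt: "compact Z" by (simp add: compact_eq_bounded_closed)
    have cover: "Z \<subseteq> (\<Union>z\<in>Z. ball z (\<rho> z))" using \<rho>(1) centre_in_ball by blast
    obtain C where C: "C \<subseteq> Z" "finite C" "Z \<subseteq> (\<Union>z\<in>C. ball z (\<rho> z))"
      by (rule compactE_image[OF cpt open_ball cover])
    have "Z \<subseteq> C" using C isolated by blast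
    with C show ?thesis using finite_subset by blast
  qed
  have "\<forall>z. \<exists>d. 0 < d \<and> (\<forall>x\<in>Z. x \<noteq> z \<longrightarrow> d \<le> dist z x)"
    using finite_set_avoid[OF finZ] by blast
  from choice[OF this] obtain d where d: "\<And>z. 0 < d z" "\<And>z x. x \<in> Z \<Longrightarrow> x \<noteq> z \<Longrightarrow> d z \<le> dist z x"
    by blast
  \<comment> \<open>\<open>d z\<close> bounds the distance to the other zeros from below, so its
    half makes the neighbourhoods disjoint; \<open>\<rho> z\<close> keeps \<open>F\<close> injective
    and the Jacobian sign constant on them.\<close>
  define U where "U z = ball z (min (\<rho> z) (d z / 2))" for z
  have U\<rho>: "U z \<subseteq> ball z (\<rho> z)" for z
    unfolding U_def by (rule subset_ball) simp
  have U: "z \<in> U z" "open (U z)" "U z \<subseteq> ?B" "inj_on F (U z)"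
    "\<And>x. x \<in> U z \<Longrightarrow> sgn (ldet (F' x)) = sgn (ldet (F' z))" if "z \<in> Z" for z
  proof -
    show "z \<in> U z" "open (U z)"
      using \<rho>(1)[OF that] d(1)[of z] by (simp_all add: U_def)
    show "U z \<subseteq> ?B"
      using U\<rho>[of z] \<rho>(2)[OF that] ball_subset_cball[of 0 r] by blast
    show "inj_on F (U z)"
      by (rule inj_on_subset[OF \<rho>(3)[OF that] U\<rho>])
    show "sgn (ldet (F' x)) = sgn (ldet (F' z))" if "x \<in> U z" for x
      using \<rho>(4)[OF \<open>z \<in> Z\<close>] U\<rho>[of z] that by blast
  qed
  have disj: "z = z'" if "z \<in> Z" "z' \<in> Z" "x \<in> U z" "x \<in> U z'" for z z' x
  proof (rule ccontr)
    assume "z \<noteq> z'"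
    then have "d z \<le> dist z z'" "d z' \<le> dist z z'"
      using d(2)[of z' z] d(2)[of z z'] that by (auto simp: dist_commute)
    moreover have "dist z z' < d z / 2 + d z' / 2"
      using that(3,4) dist_triangle[of z z' x] by (simp add: U_def dist_commute)
    ultimately show False by simp
  qed
  \<comment> \<open>What remains of the ball is compact and free of zeros, so \<open>F\<close> is
    bounded away from 0 there.\<close>
  have "closed (F ` (?B - (\<Union>z\<in>Z. U z)))"
    using U(2) by (intro compact_imp_closed compact_continuous_image continuous_on_F compact_diff) auto
  moreover have "0 \<notin> F ` (?B - (\<Union>z\<in>Z. U z))"
    using U(1) by (auto simp: Z_def)
  ultimately obtain \<epsilon>0 where \<epsilon>0: "0 < \<epsilon>0" "\<And>x. x \<in> ?B \<Longrightarrow> x \<notin> (\<Union>z\<in>Z. U z) \<Longrightarrow> \<epsilon>0 \<le> norm (F x)"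
    using separate_point_closed[of "F ` (?B - (\<Union>z\<in>Z. U z))" 0] by auto
  \<comment> \<open>Invariance of domain: each neighbourhood is mapped onto an open set, which
    contains a ball around 0.\<close>
  have openF: "open (F ` U z)" if "z \<in> Z" for z
    by (rule invariance_of_domain_gen[OF U(2)[OF that] continuous_on_F U(4)[OF that]]) simp
  have "\<forall>z\<in>Z. \<exists>e. 0 < e \<and> ball 0 e \<subseteq> F ` U z"
  proof
    fix z assume z: "z \<in> Z"
    then have "0 \<in> F ` U z"
      using U(1)[OF z] by (force simp: Z_def)
    then show "\<exists>e. 0 < e \<and> ball 0 e \<subseteq> F ` U z"
      using openF[OF z] open_contains_ball by blast
  qed
  from bchoice[OF this] obtain e where e: "\<And>z. z \<in> Z \<Longrightarrow> 0 < e z" "\<And>z. z \<in> Z \<Longrightarrow> ball 0 (e z) \<subseteq> F ` U z"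
    by blast
  \<comment> \<open>The radius of the support of the bump function: at most \<open>r\<close> to lie
    in the ball, at most \<open>\<epsilon>0\<close> for the pullback to vanish off the
    neighbourhoods, and at most every \<open>e z\<close> for each neighbourhood to be mapped over
    the whole support.\<close>
  define \<epsilon> where "\<epsilon> = Min (insert r (insert \<epsilon>0 (e ` Z)))"
  have \<epsilon>: "0 < \<epsilon>" "\<epsilon> \<le> r" "\<epsilon> \<le> \<epsilon>0" "\<And>z. z \<in> Z \<Longrightarrow> \<epsilon> \<le> e z"
  proof -
    show "0 < \<epsilon>"
      using finZ r \<epsilon>0(1) e(1) unfolding \<epsilon>_def by (subst Min_gr_iff) auto
    show "\<epsilon> \<le> r" "\<epsilon> \<le> \<epsilon>0" "\<And>z. z \<in> Z \<Longrightarrow> \<epsilon> \<le> e z"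
      using finZ unfolding \<epsilon>_def by (intro Min_le; simp)+
  qed
  define \<phi> :: "real^'n::_ \<Rightarrow> real" where "\<phi> y = max 0 (\<epsilon> - norm y)" for y
  have \<phi>: "continuous_on S \<phi>" for S
    unfolding \<phi>_def by (intro continuous_intros)
  have \<phi>_out: "\<phi> y = 0" if "y \<notin> ball 0 \<epsilon>" for y
    using that by (auto simp: \<phi>_def)
  have int: "f integrable_on ?B" if "continuous_on ?B f" for f :: "real^'n::_ \<Rightarrow> real"
    using absolutely_integrable_continuous_compact[OF compact_cball that]
    by (simp add: absolutely_integrable_on_def)
  have integral_\<phi>: "integral S \<phi> = integral UNIV \<phi>" if "ball 0 \<epsilon> \<subseteq> S" for S
  proof -
    have "integral S \<phi> = integral UNIV (\<lambda>x. if x \<in> S then \<phi> x else 0)"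
      by (rule Henstock_Kurzweil_Integration.integral_restrict_UNIV[symmetric])
    also have "(\<lambda>x. if x \<in> S then \<phi> x else 0) = \<phi>"
      using \<phi>_out that by (intro ext) (metis subsetD)
    finally show ?thesis .
  qed
  define \<psi> where "\<psi> y = \<phi> (F y) * ldet (F' y)" for y
  have \<psi>: "continuous_on S \<psi>" for S
    unfolding \<psi>_def by (intro continuous_on_mult continuous_on_ldet_F' continuous_on_compose2[OF \<phi>[of UNIV] continuous_on_F]) simp
  have \<psi>_int: "\<psi> absolutely_integrable_on ?B"
    by (intro absolutely_integrable_continuous_compact compact_cball \<psi>)
  \<comment> \<open>The constant sign of the Jacobian on \<open>U z\<close> factors out, leaving the
    absolute value that the change of variables asks for. The image of \<open>U z\<close> contains
    the support of \<open>\<phi>\<close>, so every zero contributes the same full integral up to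
    sign.\<close>
  have local: "integral (U z) \<psi> = sgn (ldet (F' z)) * integral UNIV \<phi>" if z: "z \<in> Z" for z
  proof -
    have "integral (U z) \<psi> = integral (U z) (\<lambda>x. sgn (ldet (F' z)) * (\<bar>ldet (F' x)\<bar> * \<phi> (F x)))"
    proof (rule integral_cong)
      fix x assume "x \<in> U z"
      then have "ldet (F' x) = sgn (ldet (F' z)) * \<bar>ldet (F' x)\<bar>"
        using U(5)[OF z] by (metis sgn_mult_abs)
      then show "\<psi> x = sgn (ldet (F' z)) * (\<bar>ldet (F' x)\<bar> * \<phi> (F x))"
        unfolding \<psi>_def by (metis mult.assoc mult.commute)
    qed
    also have "\<dots> = sgn (ldet (F' z)) * integral (U z) (\<lambda>x. \<bar>ldet (F' x)\<bar> * \<phi> (F x))"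
      by (rule Henstock_Kurzweil_Integration.integral_mult_right)
    also have "integral (U z) (\<lambda>x. \<bar>ldet (F' x)\<bar> * \<phi> (F x)) = integral (F ` U z) \<phi>"
    proof (rule integral_change_of_variables_scalar)
      show "U z \<in> sets lebesgue" using U(2)[OF z] by (simp add: borel_open)
      show "(F has_derivative F' x) (at x within U z)" for x
        by (rule has_derivative_at_withinI[OF derF])
      show "inj_on F (U z)" by (rule U(4)[OF z])
      have "\<phi> absolutely_integrable_on F ` ?B"
        by (intro absolutely_integrable_continuous_compact compact_continuous_image continuous_on_F compact_cball \<phi>)
      then show "\<phi> absolutely_integrable_on F ` U z"
        by (rule set_integrable_subset) (use openF[OF z] U(3)[OF z] in \<open>auto simp: borel_open\<close>)
    qed
    also have "integral (F ` U z) \<phi> = integral UNIV \<phi>"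
      using e(2)[OF z] \<epsilon>(4)[OF z] by (intro integral_\<phi>) (meson order_trans subset_ball)
    finally show ?thesis .
  qed
  have "integral ?B \<psi> = integral ?B (\<lambda>x. \<Sum>z\<in>Z. if x \<in> U z then \<psi> x else 0)"
  proof (rule integral_cong)
    fix x assume x: "x \<in> ?B"
    show "\<psi> x = (\<Sum>z\<in>Z. if x \<in> U z then \<psi> x else 0)"
    proof (cases "x \<in> (\<Union>z\<in>Z. U z)")
      case True
      then obtain z where z: "z \<in> Z" "x \<in> U z" by blast
      have "(\<Sum>z'\<in>Z. if x \<in> U z' then \<psi> x else 0) = (\<Sum>z'\<in>Z. if z' = z then \<psi> x else 0)"
        using disj z by (intro sum.cong) auto
      with finZ z show ?thesis by simp
    next
      case False
      then have "\<psi> x = 0"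
        using \<epsilon>0(2)[OF x] \<epsilon>(3) \<phi>_out[of "F x"] by (simp add: \<psi>_def)
      with False show ?thesis by (auto intro!: sum.neutral[symmetric])
    qed
  qed
  also have "\<dots> = (\<Sum>z\<in>Z. integral ?B (\<lambda>x. if x \<in> U z then \<psi> x else 0))"
  proof (rule Henstock_Kurzweil_Integration.integral_sum[OF finZ])
    fix z assume z: "z \<in> Z"
    have "\<psi> absolutely_integrable_on U z"
      by (rule set_integrable_subset[OF \<psi>_int]) (use U(2,3)[OF z] in \<open>auto simp: borel_open\<close>)
    then show "(\<lambda>x. if x \<in> U z then \<psi> x else 0) integrable_on ?B"
      using U(3)[OF z] by (simp add: integrable_restrict_Int absolutely_integrable_on_def Int_absorb2)
  qed
  also have "\<dots> = (\<Sum>z\<in>Z. integral (U z) \<psi>)"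
    using U(3) by (intro sum.cong) (auto simp: Henstock_Kurzweil_Integration.integral_restrict_Int Int_absorb2)
  also have "\<dots> = (\<Sum>z\<in>Z. sgn (ldet (F' z))) * integral UNIV \<phi>"
    by (simp add: local sum_distrib_right)
  finally have "(\<Sum>z\<in>Z. sgn (ldet (F' z))) * integral UNIV \<phi> = integral ?B \<psi>" ..
  also have "\<dots> = integral ?B \<phi>"
    unfolding \<psi>_def by (rule integral_pullback[OF \<phi>])
  also have "\<dots> = integral UNIV \<phi>"
    using \<epsilon>(2) by (intro integral_\<phi>) auto
  finally have eq: "(\<Sum>z\<in>Z. sgn (ldet (F' z))) * integral UNIV \<phi> = integral UNIV \<phi>" .
  \<comment> \<open>The tent \<open>\<phi>\<close> is at least \<open>\<epsilon> / 2\<close> on the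
    ball of half its radius, so its integral can be cancelled from \<open>eq\<close>.\<close>
  have "integral UNIV \<phi> > 0"
  proof -
    let ?b = "ball (0 :: real^'n::_) (\<epsilon> / 2)"
    have "Henstock_Kurzweil_Integration.content ?b = integral ?b (\<lambda>x. 1 :: real)"
      using lmeasure_integral[OF lmeasurable_ball, of "0 :: real^'n::_" "\<epsilon> / 2"] by simp
    then have "0 < integral ?b (\<lambda>x :: real^'n::_. 1 :: real)"
      using content_ball_pos[of "\<epsilon> / 2" "0 :: real^'n::_"] \<epsilon>(1) by (metis half_gt_zero)
    then have "0 < \<epsilon> / 2 * integral ?b (\<lambda>x :: real^'n::_. 1)"
      using \<epsilon>(1) by (intro mult_pos_pos) simp_all
    also have "\<dots> = integral ?b (\<lambda>x. \<epsilon> / 2 * 1)"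
      by (rule Henstock_Kurzweil_Integration.integral_mult_right[symmetric])
    also have "\<dots> \<le> integral ?b \<phi>"
    proof (rule integral_le)
      show "(\<lambda>x. \<epsilon> / 2 * 1) integrable_on ?b"
        by (intro integrable_on_const lmeasurable_ball)
      have "\<phi> absolutely_integrable_on ?b"
        by (rule set_integrable_subset[OF absolutely_integrable_continuous_compact[OF compact_cball \<phi>, of 0 "\<epsilon>"]])
          (use \<epsilon>(1) in auto)
      then show "\<phi> integrable_on ?b"
        by (simp add: absolutely_integrable_on_def)
    qed (auto simp: \<phi>_def max_def)
    also have "\<dots> \<le> integral ?B \<phi>"
    proof (rule integral_subset_le)
      have "\<phi> absolutely_integrable_on ?b"
        by (rule set_integrable_subset[OF absolutely_integrable_continuous_compact[OF compact_cball \<phi>, of 0 "\<epsilon>"]])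
          (use \<epsilon>(1) in auto)
      then show "\<phi> integrable_on ?b"
        by (simp add: absolutely_integrable_on_def)
    qed (use \<epsilon>(1,2) int[OF \<phi>] in \<open>auto simp: \<phi>_def\<close>)
    also have "\<dots> = integral UNIV \<phi>"
      using \<epsilon>(2) by (intro integral_\<phi>) auto
    finally show ?thesis .
  qed
  with eq have "(\<Sum>z\<in>Z. sgn (ldet (F' z))) = 1" by simp
  with finZ show ?thesis by (simp add: Z_def)
qed

end

section \<open>Reindexing determinants\<close>

text \<open>Conjugation by \<open>b\<close> matches the permutations of \<open>I\<close> and
  \<open>J\<close> and preserves signs. Working with Leibniz sums over arbitrary finite sets serves
  determinants indexed by a type and those indexed by an initial segment of the naturals
  alike.\<close>

lemma sum_permutations_reindex:
  fixes A :: "'b \<Rightarrow> 'b \<Rightarrow> 'c::comm_ring_1"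
  assumes b: "bij_betw b I J" and I: "finite I"
  shows "(\<Sum>p | p permutes J. of_int (sign p) * (\<Prod>i\<in>J. A i (p i))) =
    (\<Sum>p | p permutes I. of_int (sign p) * (\<Prod>i\<in>I. A (b i) (b (p i))))"
proof -
  have inj: "inj_on b I" using b by (rule bij_betw_imp_inj_on)
  let ?c = "inv_into I b"
  have c: "bij_betw ?c J I" using b by (rule bij_betw_inv_into)
  have cb: "?c (b x) = x" if "x \<in> I" for x using inj that by (rule inv_into_f_f)
  have bc: "b (?c x) = x" if "x \<in> J" for x using b that by (rule bij_betw_inv_into_right)
  show ?thesis
  proof (rule sum.reindex_bij_witness[of _ "map_permutation I b" "map_permutation J ?c"])
    fix p assume "p \<in> {p. p permutes J}"
    then have p: "p permutes J" by simp
    show "map_permutation I b (map_permutation J ?c p) = p"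
      using map_permutation_compose_inv[OF c p bc] .
    show "map_permutation J ?c p \<in> {p. p permutes I}"
      using map_permutation_permutes[OF c p] by simp
  next
    fix p assume "p \<in> {p. p permutes I}"
    then have p: "p permutes I" by simp
    show "map_permutation J ?c (map_permutation I b p) = p"
      using map_permutation_compose_inv[OF b p cb] .
    show "map_permutation I b p \<in> {p. p permutes J}"
      using map_permutation_permutes[OF b p] by simp
  next
    fix p assume "p \<in> {p. p permutes J}"
    then have p: "p permutes J" by simp
    have J: "finite J" using b I bij_betw_finite by blast
    have "(\<Prod>i\<in>I. A (b i) (b (map_permutation J ?c p i))) = (\<Prod>i\<in>J. A i (p i))"
    proof (rule prod.reindex_bij_witness[of _ ?c b])
      fix i assume i: "i \<in> I"
      have bi: "b i \<in> J" using b i by (rule bij_betw_apply)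
      have "map_permutation J ?c p i = map_permutation J ?c p (?c (b i))"
        using cb[OF i] by simp
      also have "\<dots> = ?c (p (b i))"
        by (rule map_permutation_apply[OF bij_betw_imp_inj_on[OF c] bi])
      finally have "b (map_permutation J ?c p i) = p (b i)"
        using bc[of "p (b i)"] permutes_in_image[OF p] bi by simp
      then show "A (b i) (p (b i)) = A (b i) (b (map_permutation J ?c p i))" by simp
    qed (use cb bc bij_betw_apply[OF b] bij_betw_apply[OF c] in auto)
    moreover have "sign (map_permutation J ?c p) = sign p"
      by (rule sign_map_permutation[OF bij_betw_imp_inj_on[OF c] p J])
    ultimately show "of_int (sign (map_permutation J ?c p)) * (\<Prod>i\<in>I. A (b i) (b (map_permutation J ?c p i))) =
        of_int (sign p) * (\<Prod>i\<in>J. A i (p i))" by simp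
  qed
qed

lemma det_reindex:
  fixes A :: "real^'n^'n" and b :: "'m::finite \<Rightarrow> 'n"
  assumes "bij b"
  shows "Determinants.det (\<chi> i j. A $ b i $ b j) = Determinants.det A"
  unfolding Determinants.det_def using sum_permutations_reindex[OF assms finite, of "\<lambda>i j. A $ i $ j"] by simp

text \<open>The bridge between the two kinds of matrices: the Hessian is indexed by natural numbers,
  the derivative of the field by the type \<open>'n\<close>.\<close>

lemma det_mat_reindex:
  fixes A :: "real^'n^'n" and b :: "nat \<Rightarrow> 'n"
  assumes "bij_betw b {0..<m} UNIV"
  shows "Determinant.det (Matrix.mat m m (\<lambda>(i, j). A $ b i $ b j)) = Determinants.det A"
proof -
  have "Determinant.det (Matrix.mat m m (\<lambda>(i, j). A $ b i $ b j)) =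
      (\<Sum>p | p permutes {0..<m}. of_int (sign p) * (\<Prod>i\<in>{0..<m}. A $ b i $ b (p i)))"
    unfolding Determinant.det_def
    by (auto intro!: sum.cong prod.cong dest: permutes_in_image)
  then show ?thesis
    unfolding Determinants.det_def using sum_permutations_reindex[OF assms, of "\<lambda>i j. A $ i $ j"] by simp
qed

text \<open>Relabelling coordinates is a linear isometry onto the well-ordered copy. It preserves
  the ball and its boundary, and conjugating \<open>F\<close> with it permutes rows and columns of
  the Jacobian alike, so zeros and signs correspond.\<close>

theorem sum_sgn_ldet:
  fixes F :: "real^'n \<Rightarrow> real^'n"
  assumes r: "0 < r"
    and derF: "\<And>x. (F has_derivative F' x) (at x)"
    and contF': "\<And>v. continuous_on UNIV (\<lambda>x. F' x v)"
    and bdry: "\<And>x. norm x = r \<Longrightarrow> F x = x"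
    and nz: "\<And>z. z \<in> cball 0 r \<Longrightarrow> F z = 0 \<Longrightarrow> ldet (F' z) \<noteq> 0"
  shows "finite {z \<in> cball 0 r. F z = 0}"
    and "(\<Sum>z | z \<in> cball 0 r \<and> F z = 0. sgn (ldet (F' z))) = 1"
proof -
  define up :: "real^'n \<Rightarrow> real^'n ix" where "up x = (\<chi> i. x $ Rep_ix i)" for x
  define dn :: "real^'n ix \<Rightarrow> real^'n" where "dn y = (\<chi> j. y $ Abs_ix j)" for y
  have updn: "up (dn y) = y" for y by (simp add: up_def dn_def Rep_ix_inverse)
  have dnup: "dn (up x) = x" for x by (simp add: up_def dn_def Abs_ix_inverse)
  have bl_up: "bounded_linear up"
    by (rule linear_conv_bounded_linear[THEN iffD1], rule linearI) (simp_all add: up_def Finite_Cartesian_Product.vec_eq_iff)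
  have bl_dn: "bounded_linear dn"
    by (rule linear_conv_bounded_linear[THEN iffD1], rule linearI) (simp_all add: dn_def Finite_Cartesian_Product.vec_eq_iff)
  have bij_Rep: "bij (Rep_ix :: 'n ix \<Rightarrow> 'n)"
    by (metis Abs_ix_inverse Rep_ix_inverse UNIV_I bijI')
  have norm_dn: "norm (dn y) = norm y" for y
  proof -
    have "(\<Sum>i\<in>UNIV. (norm (dn y $ i))\<^sup>2) = (\<Sum>i\<in>UNIV. (norm (y $ i))\<^sup>2)"
      by (rule sum.reindex_bij_betw[OF bij_Rep, symmetric, THEN trans]) (simp add: dn_def Rep_ix_inverse)
    then show ?thesis by (simp add: norm_vec_def L2_set_def)
  qed
  have norm_up: "norm (up x) = norm x" for x
    using norm_dn[of "up x"] by (simp add: dnup)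
  define G where "G y = up (F (dn y))" for y
  define G' where "G' y h = up (F' (dn y) (dn h))" for y h
  have derG: "(G has_derivative G' y) (at y)" for y
    unfolding G_def G'_def
    by (intro bounded_linear.has_derivative[OF bl_up] has_derivative_compose[OF _ derF]
        bounded_linear_imp_has_derivative bl_dn)
  have contG': "continuous_on UNIV (\<lambda>y. G' y v)" for v
    unfolding G'_def
    by (intro bounded_linear.continuous_on[OF bl_up] continuous_on_compose2[OF contF']
        linear_continuous_on bl_dn) simp
  have ldetG: "ldet (G' y) = ldet (F' (dn y))" for y
  proof -
    have "dn (axis j 1) = axis (Rep_ix j) 1" for j
      unfolding dn_def axis_def by (auto simp: Finite_Cartesian_Product.vec_eq_iff Rep_ix_inverse Abs_ix_inverse)
    then have "matrix (G' y) = (\<chi> i j. matrix (F' (dn y)) $ Rep_ix i $ Rep_ix j)"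
      by (simp add: matrix_def G'_def up_def)
    then show ?thesis by (simp add: det_reindex[OF bij_Rep])
  qed
  have up0: "up x = 0 \<longleftrightarrow> x = 0" for x
    using norm_up[of x] by (metis norm_eq_zero)
  let ?ZF = "{z \<in> cball 0 r. F z = 0}" and ?ZG = "{z \<in> cball 0 r. G z = 0}"
  have bijZ: "bij_betw dn ?ZG ?ZF"
    by (rule bij_betwI[of _ _ _ up]) (auto simp: G_def up0 norm_dn norm_up updn dnup)
  have nzG: "ldet (G' z) \<noteq> 0" if "z \<in> cball 0 r" "G z = 0" for z
    using nz[of "dn z"] that by (simp add: ldetG G_def up0 norm_dn)
  have bdryG: "G x = x" if "norm x = r" for x
    using bdry[of "dn x"] that by (simp add: G_def norm_dn updn)
  have main: "finite ?ZG \<and> (\<Sum>z\<in>?ZG. sgn (ldet (G' z))) = 1"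
    by (rule sum_sgn_ldet_wellorder[OF r derG contG' bdryG nzG])
  then show "finite ?ZF" using bij_betw_finite[OF bijZ] by blast
  show "(\<Sum>z\<in>?ZF. sgn (ldet (F' z))) = 1"
    using main sum.reindex_bij_betw[OF bijZ, of "\<lambda>z. sgn (ldet (F' z))"] by (simp add: ldetG)
qed

section \<open>Algebra: the parity of the index as the sign of a determinant\<close>

section \<open>The sign of the determinant and the number of negative eigenvalues\<close>

text \<open>The reflected polynomial \<open>q\<close>, normalized by (-1)^degree to be monic again,
  is positive far to the right; having no root in x \<ge> 0, it is still positive at 0.\<close>

lemma sgn_poly_0_no_negative_root:
  fixes p :: "real poly"
  assumes "monic p" and pos: "\<And>a. a \<le> 0 \<Longrightarrow> poly p a \<noteq> 0"
  shows "sgn (poly p 0) = (-1) ^ degree p"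
proof -
  define q where "q = Polynomial.smult ((-1) ^ degree p) (pcompose p [:0, -1:])"
  have q: "poly q x = (-1) ^ degree p * poly p (- x)" for x
    by (simp add: q_def poly_pcompose)
  have "lead_coeff (pcompose p [:0, -1:]) = (-1) ^ degree p"
    using lead_coeff_comp[of "[:0, -1:]" p] assms(1) by simp
  then have "lead_coeff q = 1"
    by (simp add: q_def lead_coeff_smult flip: power_mult_distrib)
  then obtain n where n: "\<And>x. x \<ge> n \<Longrightarrow> poly q x \<ge> 1"
    using poly_pinfty_gt_lc[of q] by auto
  have "0 < poly q 0"
  proof (rule ccontr)
    assume "\<not> 0 < poly q 0"
    moreover have "poly q 0 \<noteq> 0" using q[of 0] pos[of 0] by simp
    ultimately have neg: "poly q 0 < 0" by simp
    \<comment> \<open>\<open>max n 1\<close> instead of \<open>n\<close>, because the intermediate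
      value theorem needs a point strictly to the right of 0.\<close>
    have "1 \<le> poly q (max n 1)" by (intro n) simp
    then have "0 < poly q (max n 1)" by simp
    moreover have "0 < max n 1" by (simp add: less_max_iff_disj)
    ultimately obtain x where "0 < x" "poly q x = 0"
      using poly_IVT_pos[OF _ neg] by blast
    with q[of x] pos[of "- x"] show False by simp
  qed
  then have "0 < (-1) ^ degree p * poly p 0" using q[of 0] by simp
  then show ?thesis by (cases "even (degree p)") (auto simp: sgn_if)
qed

text \<open>Splitting off a negative root \<open>b\<close> divides the value at 0 by
  \<open>- b > 0\<close> and keeps its sign, while degree and root count both drop by one and the
  two factors -1 cancel. Once no negative root is left, the other roots do not matter, so
  polynomials that do not split over the reals are covered.\<close>

lemma sgn_poly_0_eq:
  fixes p :: "real poly"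
  assumes "monic p" "poly p 0 \<noteq> 0"
  shows "sgn (poly p 0) = (-1) ^ degree p * (-1) ^ (\<Sum>a | poly p a = 0 \<and> a < 0. order a p) \<and>
    (\<Sum>a | poly p a = 0 \<and> a < 0. order a p) \<le> degree p"
  using assms
proof (induction "degree p" arbitrary: p rule: less_induct)
  case less
  show ?case
  proof (cases "\<exists>a<0. poly p a = 0")
    case False
    then have "poly p a \<noteq> 0" if "a \<le> 0" for a
      using that less.prems(2) by (metis order.order_iff_strict)
    moreover have "(\<Sum>a | poly p a = 0 \<and> a < 0. order a p) = 0"
      by (rule sum.neutral) (use False in auto)
    ultimately show ?thesis
      using sgn_poly_0_no_negative_root[OF less.prems(1)] by simp
  next
    case True
    then obtain b where b: "b < 0" "poly p b = 0" by blast
    then obtain q where p: "p = [:- b, 1:] * q"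
      by (auto simp: poly_eq_0_iff_dvd elim: dvdE)
    have p0: "p \<noteq> 0" using less.prems(2) by auto
    then have q0: "q \<noteq> 0" using p by auto
    have deg: "degree p = Suc (degree q)"
      unfolding p using q0 by (subst degree_mult_eq) auto
    have mq: "monic q"
      using less.prems(1) unfolding p lead_coeff_mult by simp
    have qz: "poly q 0 \<noteq> 0" using less.prems(2) unfolding p by auto
    have IH: "sgn (poly q 0) = (-1) ^ degree q * (-1) ^ (\<Sum>a | poly q a = 0 \<and> a < 0. order a q)"
      "(\<Sum>a | poly q a = 0 \<and> a < 0. order a q) \<le> degree q"
      using less.hyps[OF _ mq qz] deg by auto
    let ?R = "{a. poly p a = 0 \<and> a < 0}"
    have fin: "finite ?R"
      using poly_roots_finite[OF p0] by (rule rev_finite_subset) auto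
    have bR: "b \<in> ?R" using b by simp
    have ord: "order a p = (if a = b then 1 else 0) + order a q" for a
      unfolding p by (subst order_mult) (use p0 p in \<open>auto simp: order_linear'\<close>)
    have "(\<Sum>a\<in>?R. order a p) = (\<Sum>a\<in>?R. if a = b then 1 else 0) + (\<Sum>a\<in>?R. order a q)"
      by (simp add: ord sum.distrib)
    also have "(\<Sum>a\<in>?R. if a = b then 1 else 0) = (1::nat)"
      using fin bR by simp
    also have "(\<Sum>a\<in>?R. order a q) = (\<Sum>a | poly q a = 0 \<and> a < 0. order a q)"
      by (rule sum.mono_neutral_right) (use fin in \<open>auto simp: p order_root\<close>)
    finally have sum: "(\<Sum>a\<in>?R. order a p) = Suc (\<Sum>a | poly q a = 0 \<and> a < 0. order a q)" by simp
    have "sgn (poly p 0) = sgn (poly q 0)"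
      unfolding p using b(1) by (simp add: sgn_mult)
    then show ?thesis
      using IH by (simp add: sum deg)
  qed
qed

text \<open>The characteristic polynomial takes the value (-1)^m det H at 0, and this factor (-1)^m
  cancels the one that its degree contributes to the sign.\<close>

lemma num_negative_eigenvalues:
  fixes H :: "real mat"
  assumes H: "H \<in> carrier_mat m m" and nz: "Determinant.det H \<noteq> 0"
  shows "(-1) ^ num_negative_eigenvalues H = sgn (Determinant.det H)"
    and "num_negative_eigenvalues H \<le> m"
proof -
  let ?p = "char_poly H"
  have p: "degree ?p = m" "monic ?p"
    using degree_monic_char_poly[OF H] by auto
  have eq: "num_negative_eigenvalues H = (\<Sum>a | poly ?p a = 0 \<and> a < 0. order a ?p)"
    unfolding num_negative_eigenvalues_def by (simp add: eigenvalue_root_char_poly[OF H])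
  have p0: "poly ?p 0 = (-1) ^ m * Determinant.det H"
  proof -
    have "poly ?p 0 = Determinant.det ((-1) \<cdot>\<^sub>m H)"
      unfolding char_poly_def
      by (rule poly_det_cong[of _ m]) (use H in \<open>auto simp: char_poly_matrix_def\<close>)
    with H show ?thesis by simp
  qed
  with nz have "poly ?p 0 \<noteq> 0" by simp
  from sgn_poly_0_eq[OF p(2) this] have
    s: "sgn (poly ?p 0) = (-1) ^ m * (-1) ^ num_negative_eigenvalues H" and "num_negative_eigenvalues H \<le> m"
    by (simp_all add: eq p(1))
  show "num_negative_eigenvalues H \<le> m" by fact
  have "(-1) ^ m * sgn (Determinant.det H) = (-1) ^ m * (-1) ^ num_negative_eigenvalues H"
    using s by (cases "even m") (simp_all add: p0)
  then show "(-1) ^ num_negative_eigenvalues H = sgn (Determinant.det H)"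
    by simp
qed

section \<open>Geometry: charts of the sphere and the restricted function\<close>

section \<open>Derivatives of polynomial functions\<close>

no_notation Matrix.scalar_prod (infix "\<bullet>" 70)

lemma has_derivative_frechet_polynomial_function:
  fixes f :: "'a::euclidean_space \<Rightarrow> 'b::euclidean_space"
  assumes "polynomial_function f"
  shows "(f has_derivative frechet_derivative f (at x)) (at x)"
  using differentiable_at_polynomial_function[OF assms] frechet_derivative_works by blast

lemma real_polynomial_function_frechet_derivative:
  fixes f :: "'a::euclidean_space \<Rightarrow> real"
  assumes "real_polynomial_function f"
  shows "real_polynomial_function (\<lambda>x. frechet_derivative f (at x) h)"
  using assms
proof induction
  case (linear f)
  have "frechet_derivative f (at x) = f" for x
    by (rule frechet_derivative_at[OF bounded_linear_imp_has_derivative[OF linear], symmetric])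
  then show ?case by (simp add: real_polynomial_function.intros(2))
next
  case (const c)
  show ?case by (simp add: real_polynomial_function.intros(2))
next
  case (add f g)
  have "frechet_derivative (\<lambda>x. f x + g x) (at x) = (\<lambda>h. frechet_derivative f (at x) h + frechet_derivative g (at x) h)" for x
    by (rule frechet_derivative_at[OF has_derivative_add[OF
          has_derivative_frechet_polynomial_function[OF real_polynomial_function_eq[THEN iffD1, OF add.hyps(1)]]
          has_derivative_frechet_polynomial_function[OF real_polynomial_function_eq[THEN iffD1, OF add.hyps(2)]]], symmetric])
  then show ?case using add.IH by (simp add: real_polynomial_function.intros(3))
next
  case (mult f g)
  have "frechet_derivative (\<lambda>x. f x * g x) (at x) =
      (\<lambda>h. f x * frechet_derivative g (at x) h + frechet_derivative f (at x) h * g x)" for x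
    by (rule frechet_derivative_at[OF has_derivative_mult[OF
          has_derivative_frechet_polynomial_function[OF real_polynomial_function_eq[THEN iffD1, OF mult.hyps(1)]]
          has_derivative_frechet_polynomial_function[OF real_polynomial_function_eq[THEN iffD1, OF mult.hyps(2)]]], symmetric])
  then show ?case
    using mult.IH mult.hyps by (simp add: real_polynomial_function.intros(3,4))
qed

lemma polynomial_function_frechet_derivative:
  fixes f :: "'a::euclidean_space \<Rightarrow> 'b::euclidean_space"
  assumes "polynomial_function f"
  shows "polynomial_function (\<lambda>x. frechet_derivative f (at x) h)"
proof -
  have "frechet_derivative (\<lambda>y. f y \<bullet> b) (at x) = (\<lambda>h. frechet_derivative f (at x) h \<bullet> b)" for b x
    by (rule frechet_derivative_at[OF has_derivative_inner_left[OF
          has_derivative_frechet_polynomial_function[OF assms]], symmetric])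
  then show ?thesis
    using assms real_polynomial_function_frechet_derivative[of "\<lambda>y. f y \<bullet> b" h for b]
    by (simp add: polynomial_function_iff_Basis_inner)
qed

lemma real_polynomial_function_inner_left: "real_polynomial_function (\<lambda>x. x \<bullet> v)"
  by (intro real_polynomial_function.intros(1) bounded_linear_inner_left)

lemma real_polynomial_function_inner_self: "real_polynomial_function (\<lambda>x::'a::euclidean_space. x \<bullet> x)"
  unfolding euclidean_inner[of x x for x]
  by (intro real_polynomial_function_sum real_polynomial_function.intros(4) real_polynomial_function_inner_left) auto

text \<open>
  The functions \<open>P x / (1 + x \<bullet> x)\<^sup>m\<close> with \<open>P\<close> polynomial are closed under directional derivatives,
  which makes stereographic coordinates smooth.
\<close>

lemma has_derivative_quotient_power:
  fixes P :: "'a::euclidean_space \<Rightarrow> 'b::real_normed_vector"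
  assumes "(P has_derivative D) (at x)"
  shows "((\<lambda>x. (1 / (1 + x \<bullet> x) ^ m) *\<^sub>R P x) has_derivative
    (\<lambda>h. (1 / (1 + x \<bullet> x) ^ Suc m) *\<^sub>R ((1 + x \<bullet> x) *\<^sub>R D h - (2 * real m * (x \<bullet> h)) *\<^sub>R P x))) (at x)"
proof -
  define s where "s = 1 + x \<bullet> x"
  have s: "s \<noteq> 0" by (simp add: s_def add_nonneg_eq_0_iff)
  have "((\<lambda>x. (1 + x \<bullet> x) ^ m) has_derivative (\<lambda>h. real m * (2 * (x \<bullet> h)) * s ^ (m - 1))) (at x)"
    unfolding s_def by (auto intro!: derivative_eq_intros simp: inner_commute)
  moreover have "(1 + x \<bullet> x) ^ m \<noteq> 0" using s by (simp add: s_def)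
  ultimately have "((\<lambda>x. 1 / (1 + x \<bullet> x) ^ m) has_derivative
      (\<lambda>h. (0 * s ^ m - 1 * (real m * (2 * (x \<bullet> h)) * s ^ (m - 1))) / (s ^ m * s ^ m))) (at x)"
    unfolding s_def by (intro has_derivative_divide' has_derivative_const)
  from has_derivative_scaleR[OF this assms]
  have "((\<lambda>x. (1 / (1 + x \<bullet> x) ^ m) *\<^sub>R P x) has_derivative
    (\<lambda>h. (1 / s ^ m) *\<^sub>R D h + (- (real m * (2 * (x \<bullet> h)) * s ^ (m - 1)) / (s ^ m * s ^ m)) *\<^sub>R P x)) (at x)"
    by (simp flip: s_def)
  also have "(\<lambda>h. (1 / s ^ m) *\<^sub>R D h + (- (real m * (2 * (x \<bullet> h)) * s ^ (m - 1)) / (s ^ m * s ^ m)) *\<^sub>R P x) =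
      (\<lambda>h. (1 / s ^ Suc m) *\<^sub>R (s *\<^sub>R D h - (2 * real m * (x \<bullet> h)) *\<^sub>R P x))"
  proof
    fix h
    \<comment> \<open>For \<open>m = 0\<close> the exponent \<open>m - 1\<close> is truncated, but
      the factor \<open>real m\<close> is then 0 as well.\<close>
    have "- (real m * (2 * (x \<bullet> h)) * s ^ (m - 1)) / (s ^ m * s ^ m) = - (2 * real m * (x \<bullet> h)) / s ^ Suc m"
      using s by (cases m) (simp_all add: field_simps)
    then show "(1 / s ^ m) *\<^sub>R D h + (- (real m * (2 * (x \<bullet> h)) * s ^ (m - 1)) / (s ^ m * s ^ m)) *\<^sub>R P x =
      (1 / s ^ Suc m) *\<^sub>R (s *\<^sub>R D h - (2 * real m * (x \<bullet> h)) *\<^sub>R P x)"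
      using s by (simp add: scaleR_diff_right)
  qed
  finally show ?thesis unfolding s_def .
qed

lemma smooth_on_quotient_power:
  fixes P :: "'a::euclidean_space \<Rightarrow> 'b::euclidean_space"
  assumes "polynomial_function P"
  shows "smooth_on W (\<lambda>x. (1 / (1 + x \<bullet> x) ^ m) *\<^sub>R P x)"
proof -
  have nz: "(1 + x \<bullet> x) \<noteq> 0" for x :: 'a by (simp add: add_nonneg_eq_0_iff)
  have "C_k_on k W (\<lambda>x. (1 / (1 + x \<bullet> x) ^ m) *\<^sub>R P x)" for k
    using assms
  \<comment> \<open>\<open>P\<close> and \<open>m\<close> vary because a directional derivative
    replaces them by another polynomial and \<open>Suc m\<close>.\<close>
  proof (induction k arbitrary: P m)
    case 0
    show ?case
      unfolding C_k_on.simps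
      using nz by (intro continuous_intros continuous_on_polymonial_function[OF 0]) simp
  next
    case (Suc k)
    define D where "D x = frechet_derivative P (at x)" for x
    have D: "(P has_derivative D x) (at x)" "polynomial_function (\<lambda>x. D x h)" for x h
      unfolding D_def
      by (rule has_derivative_frechet_polynomial_function[OF Suc.prems]
          polynomial_function_frechet_derivative[OF Suc.prems])+
    note der = has_derivative_quotient_power[OF D(1), of m]
    have fre: "frechet_derivative (\<lambda>x. (1 / (1 + x \<bullet> x) ^ m) *\<^sub>R P x) (at x) v =
        (1 / (1 + x \<bullet> x) ^ Suc m) *\<^sub>R ((1 + x \<bullet> x) *\<^sub>R D x v - (2 * real m * (x \<bullet> v)) *\<^sub>R P x)" for x v
      by (simp only: frechet_derivative_at[OF der, symmetric])
    have poly: "polynomial_function (\<lambda>x. (1 + x \<bullet> x) *\<^sub>R D x v - (2 * real m * (x \<bullet> v)) *\<^sub>R P x)" for v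
      by (intro polynomial_function_diff polynomial_function_mult D(2) Suc.prems
          real_polynomial_function_eq[THEN iffD1] real_polynomial_function.intros(2-4)
          real_polynomial_function_inner_self real_polynomial_function_inner_left)
    show ?case
      unfolding C_k_on.simps fre
      using der Suc.IH[OF poly] by (intro conjI ballI allI) (auto simp only: differentiable_def)
  qed
  then show ?thesis by (simp add: smooth_on_def)
qed

section \<open>Stereographic coordinates\<close>

context
  fixes p :: "real^'n"
  assumes p: "norm p = 1"
begin

text \<open>On the hyperplane orthogonal to \<open>p\<close> this is the inverse of stereographic
  projection from the antipode \<open>- p\<close>; it sends 0 to \<open>p\<close>. The exponent 1 is
  kept to fit the general form of quotient treated above.\<close>

definition stereographic :: "real^'n \<Rightarrow> real^'n" where
  "stereographic u = (1 / (1 + u \<bullet> u) ^ 1) *\<^sub>R (2 *\<^sub>R u + (1 - u \<bullet> u) *\<^sub>R p)"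

lemma inner_self_pole: "p \<bullet> p = 1"
  using p by (simp add: dot_square_norm)

lemma stereographic_inner_p:
  assumes "p \<bullet> u = 0" shows "stereographic u \<bullet> p = (1 - u \<bullet> u) / (1 + u \<bullet> u)"
  using assms by (simp add: stereographic_def inner_add_left inner_commute[of u p] inner_self_pole)

lemma stereographic_inner_self:
  assumes "p \<bullet> u = 0" shows "stereographic u \<bullet> stereographic u = 1"
proof -
  have "1 + u \<bullet> u \<noteq> 0" by (simp add: add_nonneg_eq_0_iff)
  moreover have "(2 *\<^sub>R u + (1 - u \<bullet> u) *\<^sub>R p) \<bullet> (2 *\<^sub>R u + (1 - u \<bullet> u) *\<^sub>R p) = 4 * (u \<bullet> u) + (1 - u \<bullet> u)^2"
    using assms by (simp add: inner_add_left inner_add_right inner_commute[of u p] inner_self_pole power2_eq_square)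
  then have "stereographic u \<bullet> stereographic u = (4 * (u \<bullet> u) + (1 - u \<bullet> u)^2) / (1 + u \<bullet> u)^2"
    unfolding stereographic_def by (simp add: power2_eq_square)
  moreover have "4 * (u \<bullet> u) + (1 - u \<bullet> u)^2 = (1 + u \<bullet> u)^2"
    by (simp add: power2_eq_square algebra_simps)
  ultimately show ?thesis by simp
qed

text \<open>Criticality asserts the existence of a chart, so one has to be exhibited at every point.
  This one is centred at \<open>p\<close> and covers the sphere except \<open>- p\<close>.\<close>

lemma stereographic_coordinates:
  obtains e where "sphere_coordinates_at p UNIV e stereographic 0"
proof -
  define V where "V = {x. p \<bullet> x = 0}"
  have V: "subspace V" unfolding V_def by (rule subspace_hyperplane)
  have "p \<noteq> 0" using p by auto
  then have dimV: "dim V = CARD('n) - 1"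
    unfolding V_def by (subst dim_hyperplane) simp_all
  obtain B where B: "finite B" "B \<subseteq> V" "independent B" "span B = V" "card B = dim V"
    using basis_subspace_exists[OF V] by blast
  then obtain e where "bij_betw e {0..<card B} B"
    using ex_bij_betw_nat_finite by blast
  then have e: "bij_betw e {..<CARD('n) - 1} B"
    using B(5) dimV by (simp add: atLeast0LessThan)
  then have eB: "e ` {..<CARD('n) - 1} = B" by (simp add: bij_betw_def)
  \<comment> \<open>Stereographic projection from \<open>- p\<close> to the hyperplane.\<close>
  define \<psi> where "\<psi> x = (1 / (1 + x \<bullet> p)) *\<^sub>R (x - (x \<bullet> p) *\<^sub>R p)" for x
  let ?S = "sphere 0 1 - {- p}"
  have xp: "1 + x \<bullet> p \<noteq> 0" if "x \<in> ?S" for x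
  proof
    assume "1 + x \<bullet> p = 0"
    have "x \<bullet> x = 1" using that by (simp add: dot_square_norm)
    then have "(x + p) \<bullet> (x + p) = 2 * (1 + x \<bullet> p)"
      using inner_self_pole by (simp add: inner_add_left inner_add_right inner_commute)
    with \<open>1 + x \<bullet> p = 0\<close> have "x + p = 0" by simp
    then have "x = - p" by (simp add: eq_neg_iff_add_eq_0)
    with that show False by simp
  qed
  have s: "1 + u \<bullet> u \<noteq> 0" for u :: "real^'n" by (simp add: add_nonneg_eq_0_iff)
  have st_in: "stereographic u \<in> ?S" if "u \<in> V" for u
  proof -
    have pu: "p \<bullet> u = 0" using that by (simp add: V_def)
    have "1 + stereographic u \<bullet> p = 2 / (1 + u \<bullet> u)"
      using s[of u] by (simp add: stereographic_inner_p[OF pu] field_simps)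
    then have "1 + stereographic u \<bullet> p \<noteq> 0" using s[of u] by simp
    then have "stereographic u \<noteq> - p" using inner_self_pole by auto
    moreover have "norm (stereographic u) = 1"
      using stereographic_inner_self[OF pu] by (simp add: norm_eq_1)
    ultimately show ?thesis by simp
  qed
  have \<psi>_in: "\<psi> x \<in> V" for x
    by (simp add: \<psi>_def V_def inner_diff_right inner_commute inner_self_pole)
  have \<psi>_st: "\<psi> (stereographic u) = u" if "u \<in> V" for u
  proof -
    have pu: "p \<bullet> u = 0" using that by (simp add: V_def)
    have 1: "1 + stereographic u \<bullet> p = 2 / (1 + u \<bullet> u)"
      using s[of u] by (simp add: stereographic_inner_p[OF pu] field_simps)
    have 2: "stereographic u - (stereographic u \<bullet> p) *\<^sub>R p = (2 / (1 + u \<bullet> u)) *\<^sub>R u"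
      unfolding stereographic_inner_p[OF pu] by (simp add: stereographic_def scaleR_add_right)
    define a where "a = 2 / (1 + u \<bullet> u)"
    have "a \<noteq> 0" using s[of u] by (simp add: a_def)
    then show ?thesis unfolding \<psi>_def 1 2 by (simp flip: a_def)
  qed
  have st_\<psi>: "stereographic (\<psi> x) = x" if x: "x \<in> ?S" for x
  proof -
    define c where "c = x \<bullet> p"
    have c: "1 + c \<noteq> 0" using xp[OF x] by (simp add: c_def)
    have xx: "x \<bullet> x = 1" using x by (simp add: dot_square_norm)
    have "(x - c *\<^sub>R p) \<bullet> (x - c *\<^sub>R p) = (1 + c) * (1 - c)"
      using xx inner_self_pole by (simp add: inner_diff_left inner_diff_right inner_commute c_def algebra_simps)
    then have n: "\<psi> x \<bullet> \<psi> x = (1 - c) / (1 + c)"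
      using c by (simp add: \<psi>_def flip: c_def)
    have 1: "1 + \<psi> x \<bullet> \<psi> x = 2 / (1 + c)" "1 - \<psi> x \<bullet> \<psi> x = 2 * c / (1 + c)"
      unfolding n using c by (simp_all add: field_simps)
    have "stereographic (\<psi> x) = ((1 + c) / 2) *\<^sub>R (2 *\<^sub>R \<psi> x + (2 * c / (1 + c)) *\<^sub>R p)"
      unfolding stereographic_def 1 by simp
    also have "\<dots> = ((1 + c) / 2 * 2 / (1 + c)) *\<^sub>R (x - c *\<^sub>R p) + ((1 + c) / 2 * (2 * c / (1 + c))) *\<^sub>R p"
      by (simp add: \<psi>_def scaleR_add_right flip: c_def)
    also have "\<dots> = x"
    proof -
      have "a / 2 * 2 / a = 1" "a / 2 * (2 * c / a) = c" if "a \<noteq> 0" for a :: real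
        using that by simp_all
      from this[OF c] show ?thesis by (simp only: scaleR_one diff_add_cancel)
    qed
    finally show ?thesis .
  qed
  have image: "stereographic ` V = ?S"
    using st_in \<psi>_in st_\<psi> by (metis (no_types, lifting) image_eqI image_subsetI subsetI subset_antisym)
  have image': "\<psi> ` ?S = V"
    using st_in \<psi>_in \<psi>_st by (metis (no_types, lifting) image_eqI image_subsetI subsetI subset_antisym)
  have poly: "polynomial_function (\<lambda>u. 2 *\<^sub>R u + (1 - u \<bullet> u) *\<^sub>R p)"
    by (intro polynomial_function_add polynomial_function_mult polynomial_function_cmul
        real_polynomial_function_eq[THEN iffD1] real_polynomial_function_diff real_polynomial_function.intros(2)
        real_polynomial_function_inner_self polynomial_function_id polynomial_function_const)
  have smooth: "smooth_on UNIV stereographic"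
    unfolding stereographic_def[abs_def] by (rule smooth_on_quotient_power[OF poly])
  have der: "frechet_derivative stereographic (at x) v =
      (1 / (1 + x \<bullet> x) ^ Suc 1) *\<^sub>R ((1 + x \<bullet> x) *\<^sub>R (2 *\<^sub>R v - (2 * (x \<bullet> v)) *\<^sub>R p) -
        (2 * real 1 * (x \<bullet> v)) *\<^sub>R (2 *\<^sub>R x + (1 - x \<bullet> x) *\<^sub>R p))" for x v
  proof -
    have "((\<lambda>u. 2 *\<^sub>R u + (1 - u \<bullet> u) *\<^sub>R p) has_derivative (\<lambda>v. 2 *\<^sub>R v - (2 * (x \<bullet> v)) *\<^sub>R p)) (at x)"
      by (auto intro!: derivative_eq_intros simp: inner_commute)
    from frechet_derivative_at[OF has_derivative_quotient_power[OF this, of 1], symmetric] show ?thesis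
      unfolding stereographic_def[abs_def] by (rule fun_cong)
  qed
  \<comment> \<open>The component of the derivative along \<open>p\<close> is a nonzero multiple of
    \<open>x \<bullet> v\<close>; once this vanishes, what is left is a nonzero multiple of
    \<open>v\<close>.\<close>
  have inj_der: "v = 0" if x: "x \<in> V" and v: "v \<in> V" and z: "frechet_derivative stereographic (at x) v = 0" for x v
  proof -
    have px: "x \<bullet> p = 0" "v \<bullet> p = 0" using x v by (simp_all add: V_def inner_commute)
    have *: "(1 + x \<bullet> x) *\<^sub>R (2 *\<^sub>R v - (2 * (x \<bullet> v)) *\<^sub>R p) - (2 * (x \<bullet> v)) *\<^sub>R (2 *\<^sub>R x + (1 - x \<bullet> x) *\<^sub>R p) = 0"
      using z s[of x] unfolding der by simp
    have "((1 + x \<bullet> x) *\<^sub>R (2 *\<^sub>R v - (2 * (x \<bullet> v)) *\<^sub>R p) -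
        (2 * (x \<bullet> v)) *\<^sub>R (2 *\<^sub>R x + (1 - x \<bullet> x) *\<^sub>R p)) \<bullet> p =
        (1 + x \<bullet> x) * (0 - 2 * (x \<bullet> v) * 1) - 2 * (x \<bullet> v) * (0 + (1 - x \<bullet> x) * 1)"
      by (simp only: inner_diff_left inner_add_left inner_scaleR_left px inner_self_pole mult_zero_right)
    also have "\<dots> = - 4 * (x \<bullet> v)" by (simp add: algebra_simps)
    finally have "x \<bullet> v = 0" unfolding * by simp
    with * s[of x] show "v = 0" by simp
  qed
  have "openin (top_of_set (sphere 0 1)) ?S"
    by (intro openin_diff openin_subtopology_self) (simp add: closedin_closed_eq p)
  moreover have "homeomorphism V ?S stereographic \<psi>"
    unfolding homeomorphism_def
  proof (intro conjI ballI)
    show "continuous_on V stereographic"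
      unfolding stereographic_def[abs_def] using s by (intro continuous_intros) auto
    show "continuous_on ?S \<psi>"
      unfolding \<psi>_def[abs_def] using xp by (intro continuous_intros) auto
  qed (use image image' \<psi>_st st_\<psi> in auto)
  moreover have "stereographic 0 = p" by (simp add: stereographic_def)
  ultimately have "sphere_coordinates_at p UNIV e stereographic 0"
    unfolding sphere_coordinates_at_def Int_UNIV_left eB B(4) image
    using e B(3) smooth inj_der subspace_0[OF V] by (auto simp: bij_betw_def)
  then show thesis by (rule that)
qed

end

section \<open>Local coordinates on the sphere\<close>

lemma independent_family_coefficients_zero:
  fixes e :: "'i \<Rightarrow> 'a::real_vector"
  assumes "finite I" "inj_on e I" "independent (e ` I)" "(\<Sum>i\<in>I. c i *\<^sub>R e i) = 0" "i \<in> I"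
  shows "c i = 0"
proof -
  have "(\<Sum>v\<in>e ` I. c (inv_into I e v) *\<^sub>R v) = (\<Sum>i\<in>I. c i *\<^sub>R e i)"
    using assms(2) by (simp add: sum.reindex)
  with assms(4) have "(\<Sum>v\<in>e ` I. c (inv_into I e v) *\<^sub>R v) = 0" by simp
  from independentD[OF assms(3) finite_imageI[OF assms(1)] subset_refl this, of "e i"] assms(2,5)
  show ?thesis by simp
qed

lemma smooth_on_frechet:
  assumes "smooth_on W \<phi>" "x \<in> W"
  shows "(\<phi> has_derivative frechet_derivative \<phi> (at x)) (at x)"
    and "(\<lambda>y. frechet_derivative \<phi> (at y) v) differentiable (at x)"
proof -
  have "C_k_on (Suc (Suc 0)) W \<phi>" using assms(1) by (simp only: smooth_on_def)
  then have *: "\<And>x. x \<in> W \<Longrightarrow> \<phi> differentiable (at x)"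
    "\<And>v x. x \<in> W \<Longrightarrow> (\<lambda>y. frechet_derivative \<phi> (at y) v) differentiable (at x)"
    by simp_all
  show "(\<phi> has_derivative frechet_derivative \<phi> (at x)) (at x)"
    using *(1)[OF assms(2)] frechet_derivative_works by blast
  show "(\<lambda>y. frechet_derivative \<phi> (at y) v) differentiable (at x)"
    by (rule *(2)[OF assms(2)])
qed

lemma line_has_derivative: "((\<lambda>t. x + t *\<^sub>R v) has_derivative (\<lambda>t. t *\<^sub>R v)) (at t)"
  by (auto intro!: derivative_eq_intros)

context
  fixes p :: "real^'n" and W e \<phi> u
  assumes coords: "sphere_coordinates_at p W e \<phi> u"
begin

abbreviation "tangent_map \<equiv> \<lambda>x. frechet_derivative \<phi> (at x)"

lemma coordinates_facts:
  "inj_on e {..<CARD('n) - 1}" "independent (e ` {..<CARD('n) - 1})" "open W" "smooth_on W \<phi>"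
  "openin (top_of_set (sphere 0 1)) (\<phi> ` (W \<inter> coord_space e))"
  "\<And>x v. x \<in> W \<Longrightarrow> x \<in> coord_space e \<Longrightarrow> v \<in> coord_space e \<Longrightarrow> tangent_map x v = 0 \<Longrightarrow> v = 0"
  "u \<in> W" "u \<in> coord_space e" "\<phi> u = p"
  using coords unfolding sphere_coordinates_at_def by blast+

lemma basis_in_coord_space: "i < CARD('n) - 1 \<Longrightarrow> e i \<in> coord_space e"
  by (intro span_base) auto

lemma has_derivative_chart: "x \<in> W \<Longrightarrow> (\<phi> has_derivative tangent_map x) (at x)"
  by (rule smooth_on_frechet(1)[OF coordinates_facts(4)])

lemma linear_tangent_map: "x \<in> W \<Longrightarrow> linear (tangent_map x)"
  using has_derivative_chart has_derivative_linear by blast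

lemma chart_inner_self: "x \<in> W \<Longrightarrow> x \<in> coord_space e \<Longrightarrow> \<phi> x \<bullet> \<phi> x = 1"
  using openin_imp_subset[OF coordinates_facts(5)] by (auto simp: norm_eq_1)

lemma norm_center: "norm p = 1"
  using chart_inner_self[OF coordinates_facts(7,8)] by (simp add: coordinates_facts(9) norm_eq_1)

lemma has_derivative_chart_line:
  assumes "x + t *\<^sub>R v \<in> W"
  shows "((\<lambda>t. \<phi> (x + t *\<^sub>R v)) has_derivative (\<lambda>s. s *\<^sub>R tangent_map (x + t *\<^sub>R v) v)) (at t)"
  using has_derivative_compose[OF line_has_derivative has_derivative_chart[OF assms]]
  by (simp add: linear_scale[OF linear_tangent_map[OF assms]])

lemma eventually_line:
  assumes "x \<in> W" "x \<in> coord_space e" "v \<in> coord_space e"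
  shows "\<forall>\<^sub>F t in nhds 0. x + t *\<^sub>R v \<in> W \<and> x + t *\<^sub>R v \<in> coord_space e"
proof -
  have "open ((\<lambda>t. x + t *\<^sub>R v) -` W)"
    by (intro open_vimage coordinates_facts(3) continuous_intros)
  then have "\<forall>\<^sub>F t in nhds 0. x + t *\<^sub>R v \<in> W"
    using eventually_nhds_in_open[of "(\<lambda>t. x + t *\<^sub>R v) -` W" 0] assms by simp
  then show ?thesis
    using assms by (auto elim!: eventually_mono intro: span_add span_scale)
qed

text \<open>Differentiate the constant \<open>\<phi> x \<bullet> \<phi> x\<close> along a line. It
  is known to be 1 only on \<open>W \<inter> coord_space e\<close>, so the line has to stay in the
  coordinate space.\<close>

lemma inner_chart_tangent:
  assumes x: "x \<in> W" "x \<in> coord_space e" and v: "v \<in> coord_space e"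
  shows "\<phi> x \<bullet> tangent_map x v = 0"
proof -
  have "((\<lambda>t. \<phi> (x + t *\<^sub>R v)) has_derivative (\<lambda>s. s *\<^sub>R tangent_map x v)) (at 0)"
    using has_derivative_chart_line[of x 0 v] x by simp
  from has_derivative_inner[OF this this]
  have "((\<lambda>t. \<phi> (x + t *\<^sub>R v) \<bullet> \<phi> (x + t *\<^sub>R v)) has_derivative (\<lambda>s. s * (2 * (\<phi> x \<bullet> tangent_map x v)))) (at 0)"
    by (simp add: inner_commute algebra_simps)
  moreover have "((\<lambda>t. \<phi> (x + t *\<^sub>R v) \<bullet> \<phi> (x + t *\<^sub>R v)) has_derivative (\<lambda>s. 0)) (at 0)"
  proof (rule has_derivative_transform_eventually[OF has_derivative_const[of 1]])
    show "\<forall>\<^sub>F t in at 0 within UNIV. 1 = \<phi> (x + t *\<^sub>R v) \<bullet> \<phi> (x + t *\<^sub>R v)"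
      using eventually_nhds_conv_at[THEN iffD1, OF eventually_line[OF x v]]
      by (auto elim!: eventually_mono simp: chart_inner_self)
  qed (use x chart_inner_self in auto)
  ultimately have "(\<lambda>s. s * (2 * (\<phi> x \<bullet> tangent_map x v))) = (\<lambda>s. 0)"
    by (rule has_derivative_unique)
  then show ?thesis by (metis mult_1 mult_eq_0_iff zero_neq_numeral)
qed

text \<open>The image lies in the hyperplane, and injectivity gives it the same dimension n -
  1.\<close>

lemma image_tangent_map: "tangent_map u ` coord_space e = {x. p \<bullet> x = 0}"
proof (rule subspace_dim_equal)
  have lin: "linear (tangent_map u)" by (rule linear_tangent_map[OF coordinates_facts(7)])
  show "subspace (tangent_map u ` coord_space e)" by (intro linear_subspace_image lin subspace_span)
  show "subspace {x. p \<bullet> x = 0}" by (rule subspace_hyperplane)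
  show "tangent_map u ` coord_space e \<subseteq> {x. p \<bullet> x = 0}"
    using inner_chart_tangent[OF coordinates_facts(7,8)] by (auto simp: coordinates_facts(9))
  have inj: "inj_on (tangent_map u) (coord_space e)"
    using linear_inj_on_iff_eq_0[OF lin subspace_span] coordinates_facts(6)[OF coordinates_facts(7,8)] by blast
  have "p \<noteq> 0" using norm_center by auto
  then have "dim {x. p \<bullet> x = 0} = CARD('n) - 1"
    by (subst dim_hyperplane) simp_all
  also have "\<dots> = dim (coord_space e)"
    using dim_span_eq_card_independent[OF coordinates_facts(2)] card_image[OF coordinates_facts(1)] by simp
  also have "\<dots> = dim (tangent_map u ` coord_space e)"
    using dim_image_eq[OF lin, of "coord_space e"] inj by (simp add: span_span)
  finally show "dim {x. p \<bullet> x = 0} \<le> dim (tangent_map u ` coord_space e)" by simp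
qed

context
  fixes f :: "real^'n \<Rightarrow> real" and G :: "real^'n \<Rightarrow> real^'n"
  assumes derf: "\<And>x. (f has_derivative (\<lambda>h. G x \<bullet> h)) (at x)"
begin

lemma coord_deriv_eq:
  assumes x: "x \<in> W"
  shows "coord_deriv e i (f \<circ> \<phi>) x = G (\<phi> x) \<bullet> tangent_map x (e i)"
proof -
  have "((\<lambda>t. \<phi> (x + t *\<^sub>R e i)) has_derivative (\<lambda>s. s *\<^sub>R tangent_map x (e i))) (at 0)"
    using has_derivative_chart_line[of x 0 "e i"] x by simp
  from has_derivative_compose[OF this derf]
  have "((\<lambda>t. (f \<circ> \<phi>) (x + t *\<^sub>R e i)) has_derivative (\<lambda>s. s * (G (\<phi> x) \<bullet> tangent_map x (e i)))) (at 0)"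
    by simp
  then have "((\<lambda>t. (f \<circ> \<phi>) (x + t *\<^sub>R e i)) has_field_derivative (G (\<phi> x) \<bullet> tangent_map x (e i))) (at 0)"
    by (simp add: has_field_derivative_def mult_commute_abs)
  then show ?thesis
    unfolding coord_deriv_def by (rule DERIV_imp_deriv)
qed

text \<open>The coordinate derivatives pair the gradient with vectors spanning the tangent
  hyperplane, so they vanish exactly when its tangential part is orthogonal to itself. The
  right-hand side mentions no chart, hence criticality in one chart is criticality in all.\<close>

lemma critical_iff:
  "(\<forall>i<CARD('n) - 1. coord_deriv e i (f \<circ> \<phi>) u = 0) \<longleftrightarrow> G p = (G p \<bullet> p) *\<^sub>R p"
proof
  assume *: "\<forall>i<CARD('n) - 1. coord_deriv e i (f \<circ> \<phi>) u = 0"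
  have pp: "p \<bullet> p = 1" using norm_center by (simp add: norm_eq_1)
  have lin: "linear (\<lambda>v. G p \<bullet> tangent_map u v)"
    by (rule linear_compose[OF linear_tangent_map[OF coordinates_facts(7)] bounded_linear.linear[OF bounded_linear_inner_right], unfolded o_def])
  have zero: "G p \<bullet> tangent_map u v = 0" if "v \<in> coord_space e" for v
    using linear_eq_0_on_span[OF lin _ that] * by (auto simp: coord_deriv_eq[OF coordinates_facts(7)] coordinates_facts(9))
  define w where "w = G p - (G p \<bullet> p) *\<^sub>R p"
  have "p \<bullet> w = 0" by (simp add: w_def inner_diff_right inner_commute pp)
  then obtain v where v: "v \<in> coord_space e" "w = tangent_map u v" using image_tangent_map by blast
  then have "G p \<bullet> w = 0" using zero by simp
  moreover have "w \<bullet> w = G p \<bullet> w - (G p \<bullet> p) * (p \<bullet> w)"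
    by (simp add: w_def inner_diff_left)
  ultimately have "w = 0" using \<open>p \<bullet> w = 0\<close> by simp
  then show "G p = (G p \<bullet> p) *\<^sub>R p" by (simp add: w_def)
next
  assume *: "G p = (G p \<bullet> p) *\<^sub>R p"
  show "\<forall>i<CARD('n) - 1. coord_deriv e i (f \<circ> \<phi>) u = 0"
  proof (intro allI impI)
    fix i assume "i < CARD('n) - 1"
    then have "p \<bullet> tangent_map u (e i) = 0"
      using inner_chart_tangent[OF coordinates_facts(7,8) basis_in_coord_space] by (simp add: coordinates_facts(9))
    then show "coord_deriv e i (f \<circ> \<phi>) u = 0"
      unfolding coord_deriv_eq[OF coordinates_facts(7)] coordinates_facts(9)
      by (subst *) simp
  qed
qed

text \<open>
  On the sphere \<open>G\<close> may be replaced by \<open>K y = G y - c y\<close>, as \<open>y\<close> is normal to the sphere. Since \<open>K\<close>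
  vanishes at \<open>p\<close>, the second derivatives of the chart do not contribute.
\<close>

lemma coord_Hessian_entry:
  assumes derG: "(G has_derivative H) (at p)"
    and crit: "G p = c *\<^sub>R p" and i: "i < CARD('n) - 1" and j: "j < CARD('n) - 1"
  shows "coord_deriv e i (coord_deriv e j (f \<circ> \<phi>)) u = (H (tangent_map u (e i)) - c *\<^sub>R tangent_map u (e i)) \<bullet> tangent_map u (e j)"
proof -
  let ?l = "\<lambda>t. u + t *\<^sub>R e i"
  define K where "K y = G y - c *\<^sub>R y" for y
  have derK: "(K has_derivative (\<lambda>h. H h - c *\<^sub>R h)) (at (\<phi> u))"
    unfolding K_def coordinates_facts(9) by (intro derivative_intros derG)
  have Kp: "K (\<phi> u) = 0" by (simp add: K_def crit coordinates_facts(9))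
  have d1: "((\<lambda>t. \<phi> (?l t)) has_derivative (\<lambda>s. s *\<^sub>R tangent_map u (e i))) (at 0)"
    using has_derivative_chart_line[of u 0 "e i"] coordinates_facts(7) by simp
  have d2: "((\<lambda>t. K (\<phi> (?l t))) has_derivative (\<lambda>s. H (s *\<^sub>R tangent_map u (e i)) - c *\<^sub>R (s *\<^sub>R tangent_map u (e i)))) (at 0)"
    by (rule has_derivative_compose[OF d1]) (use derK in simp)
  obtain E where E: "((\<lambda>y. tangent_map y (e j)) has_derivative E) (at u)"
    using smooth_on_frechet(2)[OF coordinates_facts(4,7)] unfolding differentiable_def by blast
  have d3: "((\<lambda>t. tangent_map (?l t) (e j)) has_derivative (\<lambda>s. E (s *\<^sub>R e i))) (at 0)"
    using has_derivative_compose[OF line_has_derivative, of "\<lambda>y. tangent_map y (e j)" E u 0 "e i"] E by simp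
  have linH: "linear (H)" using derG has_derivative_linear by blast
  from has_derivative_inner[OF d2 d3]
  have "((\<lambda>t. K (\<phi> (?l t)) \<bullet> tangent_map (?l t) (e j)) has_derivative
      (\<lambda>s. s * ((H (tangent_map u (e i)) - c *\<^sub>R tangent_map u (e i)) \<bullet> tangent_map u (e j)))) (at 0)"
    by (simp add: Kp linear_scale[OF linH] inner_diff_left algebra_simps)
  then have "((\<lambda>t. K (\<phi> (?l t)) \<bullet> tangent_map (?l t) (e j)) has_field_derivative
      (H (tangent_map u (e i)) - c *\<^sub>R tangent_map u (e i)) \<bullet> tangent_map u (e j)) (at 0)"
    by (simp add: has_field_derivative_def mult_commute_abs)
  then have "deriv (\<lambda>t. K (\<phi> (?l t)) \<bullet> tangent_map (?l t) (e j)) 0 = (H (tangent_map u (e i)) - c *\<^sub>R tangent_map u (e i)) \<bullet> tangent_map u (e j)"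
    by (rule DERIV_imp_deriv)
  \<comment> \<open>Replacing \<open>G\<close> by \<open>K\<close> is valid at all nearby points of
    the coordinate line, not just at \<open>u\<close>; a second differentiation requires
    this.\<close>
  moreover have "deriv (\<lambda>t. coord_deriv e j (f \<circ> \<phi>) (?l t)) 0 = deriv (\<lambda>t. K (\<phi> (?l t)) \<bullet> tangent_map (?l t) (e j)) 0"
  proof (rule deriv_cong_ev[OF _ refl])
    show "\<forall>\<^sub>F t in nhds 0. coord_deriv e j (f \<circ> \<phi>) (?l t) = K (\<phi> (?l t)) \<bullet> tangent_map (?l t) (e j)"
      using eventually_line[OF coordinates_facts(7,8) basis_in_coord_space[OF i]]
    proof (rule eventually_mono)
      fix t assume t: "?l t \<in> W \<and> ?l t \<in> coord_space e"
      then show "coord_deriv e j (f \<circ> \<phi>) (?l t) = K (\<phi> (?l t)) \<bullet> tangent_map (?l t) (e j)"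
        using inner_chart_tangent[OF _ _ basis_in_coord_space[OF j], of "?l t"]
        by (simp add: coord_deriv_eq K_def inner_diff_left)
    qed
  qed
  ultimately show ?thesis by (simp add: coord_deriv_def)
qed

end

end

section \<open>Synthesis: the Hessian on the sphere as a block of the Jacobian on the ball\<close>

section \<open>The thickened gradient field\<close>

text \<open>Let \<open>B\<close> have the columns \<open>a i\<close> and \<open>p\<close>. The
  matrix of all pairings of these vectors under \<open>A\<close> is B^T M B with M the matrix of
  \<open>A\<close>, so its determinant is (det B)^2 det A; it is also block triangular. The witness
  for \<open>k\<close> is the square of det B, so the choice of tangent basis cannot affect the
  sign.\<close>

lemma det_tangent_block:
  fixes A :: "real^'n \<Rightarrow> real^'n" and a :: "nat \<Rightarrow> real^'n"
  defines "m \<equiv> CARD('n) - 1"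
  assumes A: "linear A" and pp: "p \<bullet> p = 1" and tang: "\<And>i. i < m \<Longrightarrow> p \<bullet> a i = 0"
    and indep: "\<And>c i. (\<Sum>i<m. c i *\<^sub>R a i) = 0 \<Longrightarrow> i < m \<Longrightarrow> c i = 0"
    and Ap: "A p \<bullet> p = 2" and Aa: "\<And>i. i < m \<Longrightarrow> A (a i) \<bullet> p = 0"
  shows "\<exists>k>0. 2 * Determinant.det (Matrix.mat m m (\<lambda>(i, j). A (a i) \<bullet> a j)) = k * ldet A"
proof -
  define n where "n = CARD('n)"
  have n: "n = Suc m" by (simp add: n_def m_def)
  obtain \<beta> :: "nat \<Rightarrow> 'n" where \<beta>: "bij_betw \<beta> {0..<n} UNIV"
    using ex_bij_betw_nat_finite[OF finite, of "UNIV :: 'n set"] n_def by blast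
  have sum_\<beta>: "(\<Sum>k = 0..<n. g (\<beta> k)) = (\<Sum>i\<in>UNIV. g i)" for g :: "'n \<Rightarrow> real"
    by (rule sum.reindex_bij_betw[OF \<beta>])
  define b where "b i = (if i < m then a i else p)" for i
  define B where "B = Matrix.mat n n (\<lambda>(k, i). b i $ \<beta> k)"
  define M where "M = Matrix.mat n n (\<lambda>(k, l). matrix A $ \<beta> k $ \<beta> l)"
  define N where "N = Matrix.mat n n (\<lambda>(j, i). A (b i) \<bullet> b j)"
  have carr: "B \<in> carrier_mat n n" "M \<in> carrier_mat n n" "N \<in> carrier_mat n n"
    by (simp_all add: B_def M_def N_def)
  have MB: "M * B = Matrix.mat n n (\<lambda>(k, i). A (b i) $ \<beta> k)"
  proof (rule eq_matI)
    fix k i assume ki: "k < dim_row (Matrix.mat n n (\<lambda>(k, i). A (b i) $ \<beta> k))" "i < dim_col (Matrix.mat n n (\<lambda>(k, i). A (b i) $ \<beta> k))"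
    have "(M * B) $$ (k, i) = (\<Sum>l = 0..<n. matrix A $ \<beta> k $ \<beta> l * b i $ \<beta> l)"
      using ki by (simp add: M_def B_def scalar_prod_def)
    also have "\<dots> = (\<Sum>l\<in>UNIV. matrix A $ \<beta> k $ l * b i $ l)"
      by (rule sum_\<beta>[of "\<lambda>l. matrix A $ \<beta> k $ l * b i $ l"])
    also have "\<dots> = (matrix A *v b i) $ \<beta> k"
      by (simp add: matrix_vector_mult_def)
    also have "matrix A *v b i = A (b i)"
      by (rule fun_cong[OF matrix_vector_mul(2)[OF A]])
    finally show "(M * B) $$ (k, i) = Matrix.mat n n (\<lambda>(k, i). A (b i) $ \<beta> k) $$ (k, i)"
      using ki by simp
  qed (simp_all add: M_def B_def)
  have N_eq: "N = transpose_mat B * (M * B)"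
    unfolding MB
  proof (rule eq_matI)
    fix j i assume "j < dim_row (transpose_mat B * Matrix.mat n n (\<lambda>(k, i). A (b i) $ \<beta> k))"
      "i < dim_col (transpose_mat B * Matrix.mat n n (\<lambda>(k, i). A (b i) $ \<beta> k))"
    then have ji: "j < n" "i < n" by (simp_all add: B_def)
    then have "(transpose_mat B * Matrix.mat n n (\<lambda>(k, i). A (b i) $ \<beta> k)) $$ (j, i) =
        (\<Sum>k = 0..<n. b j $ \<beta> k * A (b i) $ \<beta> k)"
      by (simp add: B_def scalar_prod_def)
    also have "\<dots> = (\<Sum>k\<in>UNIV. b j $ k * A (b i) $ k)"
      by (rule sum_\<beta>[of "\<lambda>k. b j $ k * A (b i) $ k"])
    also have "\<dots> = N $$ (j, i)"
      using ji by (simp add: N_def inner_vec_def mult.commute)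
    finally show "N $$ (j, i) = (transpose_mat B * Matrix.mat n n (\<lambda>(k, i). A (b i) $ \<beta> k)) $$ (j, i)" ..
  qed (simp_all add: N_def B_def)
  have det_N: "Determinant.det N = (Determinant.det B)\<^sup>2 * ldet A"
  proof -
    have "Determinant.det N = Determinant.det (transpose_mat B) * (Determinant.det M * Determinant.det B)"
      unfolding N_eq
      using Determinant.det_mult[OF transpose_carrier_mat[THEN iffD2, OF carr(1)] mult_carrier_mat[OF carr(2,1)]]
        Determinant.det_mult[OF carr(2,1)] by simp
    also have "Determinant.det M = ldet A"
      unfolding M_def by (rule det_mat_reindex[OF \<beta>])
    finally show ?thesis
      using Determinant.det_transpose[OF carr(1)] by (simp add: power2_eq_square)
  qed
  let ?h = "Matrix.mat m m (\<lambda>(i, j). A (a i) \<bullet> a j)"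
  \<comment> \<open>The last row pairs with \<open>p\<close>: it is 0 on tangent vectors by
    \<open>Aa\<close> and 2 in the corner by \<open>Ap\<close>. The indices of \<open>?h\<close> run
    the other way round, hence the transpose.\<close>
  have "N = four_block_mat (transpose_mat ?h) (Matrix.mat m 1 (\<lambda>(j, i). A p \<bullet> a j)) (0\<^sub>m 1 m) (Matrix.mat 1 1 (\<lambda>_. 2))"
    by (rule eq_matI) (auto simp: N_def n b_def Aa Ap less_Suc_eq)
  then have "Determinant.det N = Determinant.det (transpose_mat ?h) * Determinant.det (Matrix.mat 1 1 (\<lambda>_. 2 :: real))"
    by (simp add: det_four_block_mat_lower_left_zero[of _ m _ 1])
  also have "\<dots> = 2 * Determinant.det ?h"
    by (subst Determinant.det_transpose[of _ m]) (simp_all add: det_single)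
  finally have *: "2 * Determinant.det ?h = (Determinant.det B)\<^sup>2 * ldet A"
    using det_N by simp
  \<comment> \<open>A kernel vector of \<open>B\<close> is a linear relation between the
    \<open>a i\<close> and \<open>p\<close>; pairing it with \<open>p\<close> kills the last
    coefficient, and independence the others.\<close>
  have "Determinant.det B \<noteq> 0"
  proof
    assume "Determinant.det B = 0"
    then obtain v where v: "v \<in> carrier_vec n" "v \<noteq> 0\<^sub>v n" "B *\<^sub>v v = 0\<^sub>v n"
      using det_0_iff_vec_prod_zero_field[OF carr(1)] by blast
    define c where "c i = vec_index v i" for i
    have "(\<Sum>i = 0..<n. c i *\<^sub>R b i) = 0"
    proof (subst Finite_Cartesian_Product.vec_eq_iff, intro allI)
      fix x :: 'n
      obtain k where k: "k < n" "x = \<beta> k" using \<beta> by (metis UNIV_I atLeastLessThan_iff bij_betw_imp_surj_on imageE)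
      have "vec_index (B *\<^sub>v v) k = 0" using v(3) k(1) by simp
      moreover have "vec_index (B *\<^sub>v v) k = (\<Sum>i = 0..<n. b i $ \<beta> k * c i)"
        using k(1) v(1) by (simp add: B_def scalar_prod_def c_def)
      ultimately show "(\<Sum>i = 0..<n. c i *\<^sub>R b i) $ x = 0 $ x"
        by (simp add: k(2) mult.commute)
    qed
    then have sum0: "(\<Sum>i<m. c i *\<^sub>R a i) + c m *\<^sub>R p = 0"
      by (simp add: n b_def atLeast0LessThan)
    have "p \<bullet> ((\<Sum>i<m. c i *\<^sub>R a i) + c m *\<^sub>R p) = c m"
      using tang by (simp add: inner_add_right inner_sum_right pp)
    then have cm: "c m = 0" using sum0 by simp
    then have "c i = 0" if "i < n" for i
      using indep[of c i] sum0 that by (cases "i = m") (auto simp: n)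
    then have "v = 0\<^sub>v n"
      using v(1) by (intro eq_vecI) (auto simp: c_def)
    with v(2) show False by simp
  qed
  then have "0 < (Determinant.det B)\<^sup>2" by simp
  with * show ?thesis by blast
qed

lemma ldet_uminus: "ldet (\<lambda>h::real^'n. - h) = (-1) ^ CARD('n)"
proof -
  have "(\<lambda>h::real^'n. - h) = (*\<^sub>R) (-1)" by (simp add: fun_eq_iff)
  then show ?thesis using det_matrix_scaleR by metis
qed

context
  fixes f :: "real^'n \<Rightarrow> real" and G :: "real^'n \<Rightarrow> real^'n" and H :: "real^'n \<Rightarrow> real^'n \<Rightarrow> real^'n"
  assumes derf: "\<And>x. (f has_derivative (\<lambda>h. G x \<bullet> h)) (at x)"
    and derG: "\<And>x. (G has_derivative H x) (at x)"
    and contH: "\<And>v. continuous_on UNIV (\<lambda>x. H x v)"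
begin

text \<open>
  \<open>tangential y\<close> is \<open>y \<bullet> y\<close> times the projection of the gradient \<open>G y\<close> to the hyperplane orthogonal to
  \<open>y\<close>. The field \<open>thickened\<close> has radial component \<open>(y \<bullet> y - 1) y\<close> and is the identity on the sphere of
  radius \<open>sqrt 2\<close>.
\<close>

definition "tangential y = (y \<bullet> y) *\<^sub>R G y - (G y \<bullet> y) *\<^sub>R y"

definition "tangential' y h = (2 * (y \<bullet> h)) *\<^sub>R G y + (y \<bullet> y) *\<^sub>R H y h
  - (H y h \<bullet> y + G y \<bullet> h) *\<^sub>R y - (G y \<bullet> y) *\<^sub>R h"

definition "thickened y = y + (2 - y \<bullet> y) *\<^sub>R (tangential y - y)"

definition "thickened' y h = h + (2 - y \<bullet> y) *\<^sub>R (tangential' y h - h) - (2 * (y \<bullet> h)) *\<^sub>R (tangential y - y)"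

lemma continuous_on_G: "continuous_on S G"
  using derG by (intro has_derivative_continuous_on) (auto intro: has_derivative_at_withinI)

lemma has_derivative_tangential: "(tangential has_derivative tangential' y) (at y)"
proof -
  have "(tangential has_derivative (\<lambda>h. ((y \<bullet> y) *\<^sub>R H y h + (y \<bullet> h + h \<bullet> y) *\<^sub>R G y)
      - ((G y \<bullet> y) *\<^sub>R h + (G y \<bullet> h + H y h \<bullet> y) *\<^sub>R y))) (at y)"
    unfolding tangential_def[abs_def]
    by (intro has_derivative_diff has_derivative_scaleR has_derivative_inner has_derivative_ident derG)
  also have "(\<lambda>h. ((y \<bullet> y) *\<^sub>R H y h + (y \<bullet> h + h \<bullet> y) *\<^sub>R G y)
      - ((G y \<bullet> y) *\<^sub>R h + (G y \<bullet> h + H y h \<bullet> y) *\<^sub>R y)) = tangential' y"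
    by (rule ext) (simp add: tangential'_def inner_commute algebra_simps)
  finally show ?thesis .
qed

lemma has_derivative_thickened: "(thickened has_derivative thickened' y) (at y)"
proof -
  have "(thickened has_derivative (\<lambda>h. h + ((2 - y \<bullet> y) *\<^sub>R (tangential' y h - h)
      + (0 - (y \<bullet> h + h \<bullet> y)) *\<^sub>R (tangential y - y)))) (at y)"
    unfolding thickened_def[abs_def]
    by (intro has_derivative_add has_derivative_diff has_derivative_scaleR has_derivative_inner
        has_derivative_ident has_derivative_const has_derivative_tangential)
  also have "(\<lambda>h. h + ((2 - y \<bullet> y) *\<^sub>R (tangential' y h - h)
      + (0 - (y \<bullet> h + h \<bullet> y)) *\<^sub>R (tangential y - y))) = thickened' y"
    by (rule ext) (simp add: thickened'_def inner_commute algebra_simps)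
  finally show ?thesis .
qed

lemma continuous_on_thickened': "continuous_on UNIV (\<lambda>y. thickened' y v)"
  unfolding thickened'_def tangential'_def tangential_def
  by (intro continuous_intros continuous_on_G contH)

lemma tangential_orthogonal: "tangential y \<bullet> y = 0"
  by (simp add: tangential_def inner_diff_left)

lemma tangential_eq_0_iff:
  assumes "norm p = 1" shows "tangential p = 0 \<longleftrightarrow> G p = (G p \<bullet> p) *\<^sub>R p"
  using assms by (simp add: tangential_def norm_eq_1)

lemma thickened_eq_0_iff: "thickened y = 0 \<longleftrightarrow> y = 0 \<or> norm y = 1 \<and> tangential y = 0"
proof
  assume z: "thickened y = 0"
  have "thickened y \<bullet> y = (y \<bullet> y) * (y \<bullet> y - 1)"
    by (simp add: thickened_def inner_add_left inner_diff_left tangential_orthogonal algebra_simps)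
  with z have "y = 0 \<or> y \<bullet> y = 1" by simp
  with z show "y = 0 \<or> norm y = 1 \<and> tangential y = 0"
    by (auto simp: norm_eq_1 thickened_def)
next
  assume "y = 0 \<or> norm y = 1 \<and> tangential y = 0"
  then show "thickened y = 0"
    by (auto simp: thickened_def norm_eq_1 tangential_def)
qed

lemma ldet_thickened'_0: "ldet (thickened' 0) = (-1) ^ CARD('n)"
proof -
  have "thickened' 0 = (\<lambda>h. - h)"
    by (rule ext) (simp add: thickened'_def tangential'_def scaleR_2)
  then show ?thesis by (simp add: ldet_uminus)
qed

lemma critical_point_iff:
  assumes "norm p = 1"
  shows "sphere_critical_point f p \<longleftrightarrow> tangential p = 0"
proof
  assume "sphere_critical_point f p"
  then obtain W e \<phi> u where "sphere_coordinates_at p W e \<phi> u"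
    "\<forall>i < CARD('n) - 1. coord_deriv e i (f \<circ> \<phi>) u = 0"
    unfolding sphere_critical_point_def by blast
  then show "tangential p = 0"
    using critical_iff[OF _ derf] tangential_eq_0_iff[OF assms] by blast
next
  assume t: "tangential p = 0"
  obtain e where "sphere_coordinates_at p UNIV e (stereographic p) 0"
    using stereographic_coordinates[OF assms] by blast
  then show "sphere_critical_point f p"
    unfolding sphere_critical_point_def
    using critical_iff[OF _ derf] tangential_eq_0_iff[OF assms] t by blast
qed

text \<open>On tangent vectors \<open>thickened' p\<close> is \<open>H p h - c *\<^sub>R h\<close>
  up to a multiple of \<open>p\<close>, and such a multiple is invisible when paired with tangent
  vectors. The Hessian is thus the tangential block of the Jacobian, whichever chart is
  used.\<close>

lemma sgn_det_coord_Hessian: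
  assumes coords: "sphere_coordinates_at p W e \<phi> u" and crit: "tangential p = 0"
  shows "sgn (Determinant.det (coord_Hessian e (f \<circ> \<phi>) u)) = sgn (ldet (thickened' p))"
proof -
  let ?m = "CARD('n) - 1"
  note facts = coordinates_facts[OF coords]
  define a where "a i = frechet_derivative \<phi> (at u) (e i)" for i
  \<comment> \<open>The Lagrange multiplier of the critical point.\<close>
  define c where "c = G p \<bullet> p"
  have np: "norm p = 1" by (rule norm_center[OF coords])
  then have pp: "p \<bullet> p = 1" by (simp add: norm_eq_1)
  have Gp: "G p = c *\<^sub>R p"
    using crit tangential_eq_0_iff[OF np] by (simp add: c_def)
  have tang: "p \<bullet> a i = 0" if "i < ?m" for i
    using inner_chart_tangent[OF coords facts(7,8) basis_in_coord_space[OF coords that]] by (simp add: a_def facts(9))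
  have A_tang: "thickened' p h = H p h - (H p h \<bullet> p) *\<^sub>R p - c *\<^sub>R h" if "p \<bullet> h = 0" for h
    using that by (simp add: thickened'_def tangential'_def pp Gp crit)
  \<comment> \<open>\<open>tangential' p p\<close> has no component along \<open>p\<close>; the 2
    comes from differentiating the weight \<open>2 - y \<bullet> y\<close> in front of
    \<open>- y\<close>.\<close>
  have Ap: "thickened' p p \<bullet> p = 2"
    by (simp add: thickened'_def tangential'_def pp Gp crit inner_add_left inner_diff_left)
  have lin: "linear (thickened' p)"
    using has_derivative_thickened has_derivative_linear by blast
  have indep: "k i = 0" if "(\<Sum>i<?m. k i *\<^sub>R a i) = 0" "i < ?m" for k i
  proof -
    let ?v = "\<Sum>i<?m. k i *\<^sub>R e i"
    have "frechet_derivative \<phi> (at u) ?v = (\<Sum>i<?m. k i *\<^sub>R a i)"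
      using linear_tangent_map[OF coords facts(7)] by (simp add: linear_sum linear_scale a_def)
    moreover have "?v \<in> coord_space e"
      by (intro span_sum span_scale basis_in_coord_space[OF coords]) simp
    ultimately have "?v = 0" using facts(6)[OF facts(7,8)] that(1) by simp
    then show ?thesis
      using independent_family_coefficients_zero[OF _ facts(1,2)] that(2) by simp
  qed
  have hess: "coord_Hessian e (f \<circ> \<phi>) u = Matrix.mat ?m ?m (\<lambda>(i, j). thickened' p (a i) \<bullet> a j)"
    unfolding coord_Hessian_def
  proof (rule Matrix.cong_mat[OF refl refl], clarify)
    fix i j assume ij: "i < ?m" "j < ?m"
    show "coord_deriv e i (coord_deriv e j (f \<circ> \<phi>)) u = thickened' p (a i) \<bullet> a j"
      using coord_Hessian_entry[OF coords derf derG[of p] Gp ij] tang[OF ij(2)]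
      by (simp add: A_tang[OF tang[OF ij(1)]] inner_diff_left flip: a_def)
  qed
  have ap: "thickened' p (a i) \<bullet> p = 0" if "i < ?m" for i
    using tang[OF that] by (simp add: A_tang[OF tang[OF that]] inner_diff_left pp inner_commute[of "a i"])
  have "\<exists>k>0. 2 * Determinant.det (coord_Hessian e (f \<circ> \<phi>) u) = k * ldet (thickened' p)"
    unfolding hess by (rule det_tangent_block[of "thickened' p" p a]) (fact lin pp tang indep Ap ap)+
  then obtain k where k: "0 < k" "2 * Determinant.det (coord_Hessian e (f \<circ> \<phi>) u) = k * ldet (thickened' p)"
    by blast
  then have "sgn (2 * Determinant.det (coord_Hessian e (f \<circ> \<phi>) u)) = sgn (k * ldet (thickened' p))"
    by simp
  with k(1) show ?thesis by (simp add: sgn_mult)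
qed

text \<open>The chart picked by \<open>SOME\<close> may differ from the one that witnesses
  nondegeneracy. Both Hessian determinants have the sign of \<open>ldet (thickened' p)\<close>, so
  nonsingularity passes from one chart to the other and the parity of the index is
  determined.\<close>

lemma minus_one_power_morse_index:
  assumes "sphere_nondegenerate_critical_point f p" "norm p = 1"
  shows "(-1) ^ sphere_morse_index f p = sgn (ldet (thickened' p))"
    and "sphere_morse_index f p \<le> CARD('n) - 1" and "ldet (thickened' p) \<noteq> 0"
proof -
  have crit: "tangential p = 0"
    using assms critical_point_iff unfolding sphere_nondegenerate_critical_point_def by blast
  obtain W e \<phi> u where c: "sphere_coordinates_at p W e \<phi> u"
    and nz: "Determinant.det (coord_Hessian e (f \<circ> \<phi>) u) \<noteq> 0"
    using assms(1) unfolding sphere_nondegenerate_critical_point_def by blast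
  show nz': "ldet (thickened' p) \<noteq> 0"
    using sgn_det_coord_Hessian[OF c crit] nz by (metis sgn_0_0)
  have "\<exists>W e \<phi> u. sphere_coordinates_at p W e \<phi> u \<and>
        sphere_morse_index f p = num_negative_eigenvalues (coord_Hessian e (f \<circ> \<phi>) u)"
    unfolding sphere_morse_index_def by (rule someI_ex) (use c in blast)
  then obtain W' e' \<phi>' u' where c': "sphere_coordinates_at p W' e' \<phi>' u'"
    and k: "sphere_morse_index f p = num_negative_eigenvalues (coord_Hessian e' (f \<circ> \<phi>') u')"
    by blast
  note sg = sgn_det_coord_Hessian[OF c' crit]
  have nz2: "Determinant.det (coord_Hessian e' (f \<circ> \<phi>') u') \<noteq> 0"
    using sg nz' by (metis sgn_0_0)
  have carr: "coord_Hessian e' (f \<circ> \<phi>') u' \<in> carrier_mat (CARD('n) - 1) (CARD('n) - 1)"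
    by (simp add: coord_Hessian_def)
  show "(-1) ^ sphere_morse_index f p = sgn (ldet (thickened' p))"
    "sphere_morse_index f p \<le> CARD('n) - 1"
    using num_negative_eigenvalues[OF carr nz2] by (simp_all add: k sg)
qed

theorem sum_morse_index:
  assumes nondeg: "\<And>p. norm p = 1 \<Longrightarrow> sphere_critical_point f p \<Longrightarrow> sphere_nondegenerate_critical_point f p"
  defines "E \<equiv> {p. norm p = 1 \<and> sphere_critical_point f p}"
  shows "finite E" "(\<Sum>p\<in>E. (-1) ^ sphere_morse_index f p) = (1 - (-1) ^ CARD('n) :: real)"
    "\<And>p. p \<in> E \<Longrightarrow> sphere_morse_index f p \<le> CARD('n) - 1"
proof -
  let ?r = "sqrt 2"
  have E: "(-1) ^ sphere_morse_index f p = sgn (ldet (thickened' p))"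
    "sphere_morse_index f p \<le> CARD('n) - 1" "ldet (thickened' p) \<noteq> 0" if "p \<in> E" for p
    using minus_one_power_morse_index[of p] nondeg[of p] that by (auto simp: E_def)
  show "sphere_morse_index f p \<le> CARD('n) - 1" if "p \<in> E" for p
    by (rule E(2)[OF that])
  have zeros: "{z \<in> cball 0 ?r. thickened z = 0} = insert 0 E"
    by (auto simp: thickened_eq_0_iff E_def critical_point_iff)
  have bdry: "thickened x = x" if "norm x = ?r" for x
    using that by (simp add: thickened_def dot_square_norm)
  have nz: "ldet (thickened' z) \<noteq> 0" if "z \<in> cball 0 ?r" "thickened z = 0" for z
  proof -
    have "z = 0 \<or> z \<in> E" using that zeros by blast
    then show ?thesis using E(3) ldet_thickened'_0 by auto
  qed
  have r: "0 < ?r" by simp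
  have deg: "finite {z \<in> cball 0 ?r. thickened z = 0}"
    "(\<Sum>z | z \<in> cball 0 ?r \<and> thickened z = 0. sgn (ldet (thickened' z))) = 1"
    by (rule sum_sgn_ldet[of ?r thickened thickened'];
        fact r has_derivative_thickened continuous_on_thickened' bdry nz)+
  show fin: "finite E" using deg(1) zeros by simp
  have "0 \<notin> E" by (simp add: E_def)
  have "(\<Sum>z\<in>insert 0 E. sgn (ldet (thickened' z))) = 1"
    using deg(2) zeros by simp
  then have "sgn ((-1) ^ CARD('n)) + (\<Sum>p\<in>E. sgn (ldet (thickened' p))) = (1 :: real)"
    using fin \<open>0 \<notin> E\<close> by (simp add: ldet_thickened'_0)
  moreover have "sgn ((-1) ^ CARD('n)) = ((-1) ^ CARD('n) :: real)"
    by (cases "even CARD('n)") auto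
  ultimately show "(\<Sum>p\<in>E. (-1) ^ sphere_morse_index f p) = (1 - (-1) ^ CARD('n) :: real)"
    using E(1) by simp
qed

end

section \<open>Eigenvectors of tensors\<close>

lemma real_polynomial_function_tensor_poly:
  fixes T :: "'n::finite list \<Rightarrow> real"
  shows "real_polynomial_function (tensor_poly d T)"
proof -
  have "finite {is :: 'n list. length is = d}"
    using finite_lists_length_eq[of "UNIV :: 'n set" d] by simp
  then show ?thesis
    unfolding tensor_poly_def[abs_def]
    by (intro real_polynomial_function_sum real_polynomial_function.intros(1,2,4) real_polynomial_function_prod
        bounded_linear_vec_nth) auto
qed

theorem theorem5p4:
  fixes T :: "'n::finite list \<Rightarrow> real" and d :: nat
  assumes "d \<ge> 1"
    and "symmetric_tensor d T"
    and "nondegenerate_tensor d T"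
  shows "(\<Sum>l = 0..CARD('n) - 1. (-1) ^ l * int (num_eigenvectors_of_index d T l)) =
    (if even CARD('n) then 0 else 2)"
proof -
  let ?f = "tensor_poly d T" and ?idx = "sphere_morse_index (tensor_poly d T)"
  \<comment> \<open>The gradient, assembled from partial derivatives. In this form it is visibly
    polynomial, which provides the continuous second derivatives.\<close>
  define G where "G x = (\<Sum>b\<in>Basis. frechet_derivative ?f (at x) b *\<^sub>R b)" for x
  define E where "E = unit_eigenvectors d T"
  note poly = real_polynomial_function_tensor_poly[of d T]
  have derf: "(?f has_derivative (\<lambda>h. G x \<bullet> h)) (at x)" for x
  proof -
    have d: "(?f has_derivative frechet_derivative ?f (at x)) (at x)"
      using poly by (intro has_derivative_frechet_polynomial_function) (simp add: real_polynomial_function_eq)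
    have "frechet_derivative ?f (at x) h = G x \<bullet> h" for h
    proof -
      have "frechet_derivative ?f (at x) h = frechet_derivative ?f (at x) (\<Sum>b\<in>Basis. (h \<bullet> b) *\<^sub>R b)"
        by (simp add: euclidean_representation)
      also have "\<dots> = G x \<bullet> h"
        using has_derivative_linear[OF d]
        by (simp add: linear_sum linear_scale G_def inner_sum_left inner_sum_right inner_commute mult.commute)
      finally show ?thesis .
    qed
    with d show ?thesis by (metis (no_types, lifting) ext)
  qed
  have polyG: "polynomial_function G"
    unfolding G_def[abs_def]
    by (intro polynomial_function_sum polynomial_function_mult polynomial_function_const finite_Basis
        real_polynomial_function_eq[THEN iffD1] real_polynomial_function_frechet_derivative poly)
  note derG = has_derivative_frechet_polynomial_function[OF polyG]
  have contH: "continuous_on UNIV (\<lambda>x. frechet_derivative G (at x) v)" for v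
    by (intro continuous_on_polymonial_function polynomial_function_frechet_derivative polyG)
  have E_eq: "E = {p. norm p = 1 \<and> sphere_critical_point ?f p}"
    by (simp add: E_def unit_eigenvectors_def)
  have nondeg: "sphere_nondegenerate_critical_point ?f p"
    if "norm p = 1" "sphere_critical_point ?f p" for p
    using assms(3) that by (simp add: nondegenerate_tensor_def unit_eigenvectors_def)
  note main = sum_morse_index[OF derf derG contH nondeg, folded E_eq]
  have "(\<Sum>l = 0..CARD('n) - 1. (-1) ^ l * int (num_eigenvectors_of_index d T l)) =
      (\<Sum>l = 0..CARD('n) - 1. \<Sum>x | x \<in> E \<and> ?idx x = l. (-1) ^ ?idx x)"
    by (intro sum.cong refl) (simp add: num_eigenvectors_of_index_def E_def mult.commute)
  \<comment> \<open>Grouping by index needs finitely many eigenvectors and the bound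
    \<open>CARD('n) - 1\<close> on their indices.\<close>
  also have "\<dots> = (\<Sum>x\<in>E. (-1) ^ ?idx x)"
    by (rule sum.group) (use main(1,3) in auto)
  finally have "real_of_int (\<Sum>l = 0..CARD('n) - 1. (-1) ^ l * int (num_eigenvectors_of_index d T l)) =
      1 - (-1) ^ CARD('n)"
    using main(2) by simp
  also have "\<dots> = real_of_int (if even CARD('n) then 0 else 2)" by simp
  finally show ?thesis by (simp only: of_int_eq_iff)
qed

end
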